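(* Let $M$ be a locally compact Polish space with a positive, locally finite Borel measure $\mu$ of full topological support, and let $\{U_t:t\ge 0\}$ be a strongly continuous semigroup of bounded, positivity preserving linear operators on $L^2(M,\mu)$ with adjoint semigroup $\{U_t^*:t\ge 0\}$, both given for $t>0$ by a real-valued measurable kernel $u_t(x,y)$. Fix $t_0>0$ and assume: every $U_t$, $t>0$, is compact on $L^2(M,\mu)$; $U_{t_0}$ is positivity improving; both semigroups have the strong Feller property; and $U_{t_0},U_{t_0}^*:L^2(M,\mu)\to L^\infty(M,\mu)$ are bounded. Let $\lambda_0,\phi_0,\psi_0,\Lambda,\gamma$ be as defined in the context. If there exists some $t_1\ge t_0$ such that the heat content satisfies $Z(t_1)<\infty$, then there is some $C>0$ such that $$\left|e^{\lambda_0t}Z(t)-\frac{\|\phi_0\|_1\|\psi_0\|_1}{\Lambda}\right|\le Ce^{-\gamma t},\qquad t>6t_1.$$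
   Context: Neither compactness of $M$ nor finiteness of $\mu$ is assumed. $\mathbf 1_M$ is the constant function $1$; $\|\cdot\|_1$ is the $L^1(M,\mu)$ norm. Kernels: $U_tf(x)=\int u_t(x,y)f(y)\,\mu(dy)$ and $U_t^*g(y)=\int u_t(x,y)g(x)\,\mu(dx)$, $t>0$; these formulas also define $U_t,U_t^*$ on $L^\infty$. Positivity preserving: $f\ge0$ a.e. implies $U_tf\ge 0$ a.e. Positivity improving: $f\ge 0$, $f\not\equiv 0$ in $L^2$ implies $U_{t_0}f>0$ $\mu$-a.e. Strong Feller property: for every $t>0$ and $f\in L^\infty(M,\mu)$ one has $U_tf,U_t^*f\in C_b(M)$. Ground states: with $A$ the generator of $\{U_t\}$ and $A^*$ that of $\{U_t^*\}$, $\lambda_0:=\inf\mathrm{Re}(\mathrm{Spec}(-A))=\inf\mathrm{Re}(\mathrm{Spec}(-A^* ))$ is a joint isolated simple eigenvalue of $-A$ and $-A^*$, with $L^2$-normalized, $\mu$-a.e. strictly positive eigenfunctions $\phi_0$ (of $-A$) and $\psi_0$ (of $-A^*$), so $U_t\phi_0=e^{-\lambda_0t}\phi_0$, $U_t^*\psi_0=e^{-\lambda_0t}\psi_0$; they have continuous bounded versions. Set $\Lambda:=\int\phi_0\psi_0\,d\mu$. The constant $\gamma$: under the assumptions there are constants $C_0,\gamma>0$ (known result) such that $|e^{\lambda_0t}u_t(x,y)-\Lambda^{-1}\phi_0(x)\psi_0(y)|\le C_0e^{-\gamma t}$ for all $t>2t_0$ and $\mu\otimes\mu$-a.a. $(x,y)$;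 such a $\gamma$ is fixed. Heat content: $Z(t):=\int U_t\mathbf 1_M\,d\mu=\int U_t^*\mathbf 1_M\,d\mu=\iint u_t(x,y)\,\mu(dx)\mu(dy)\in(0,\infty]$. *)

theory Defs
  imports "HOL-Analysis.Analysis" "HOL-Library.Complex_Order"
begin

text \<open>
  The Hilbert space \<open>L\<^sup>2(M,\<mu>)\<close> is complex (its operators have spectra in the complex plane). Its elements
  are handled through representatives, and two representatives are identified by stating every equation
  only \<open>\<mu>\<close>-almost everywhere or up to the \<open>L\<^sup>2\<close>-seminorm. The order on the complex numbers is that of
  \<open>Complex_Order\<close>: \<open>0 \<le> z\<close> means that \<open>z\<close> is real and nonnegative.
\<close>

definition L2 :: "'a measure \<Rightarrow> ('a \<Rightarrow> complex) set" where
  "L2 \<mu> = {f \<in> borel_measurable \<mu>. integrable \<mu> (\<lambda>x. (norm (f x))\<^sup>2)}"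

definition l2norm :: "'a measure \<Rightarrow> ('a \<Rightarrow> complex) \<Rightarrow> real" where
  "l2norm \<mu> f = sqrt (\<integral>x. (norm (f x))\<^sup>2 \<partial>\<mu>)"

definition l2inner :: "'a measure \<Rightarrow> ('a \<Rightarrow> complex) \<Rightarrow> ('a \<Rightarrow> complex) \<Rightarrow> complex" where
  "l2inner \<mu> f g = (\<integral>x. f x * cnj (g x) \<partial>\<mu>)"

definition Linf :: "'a measure \<Rightarrow> ('a \<Rightarrow> complex) set" where
  "Linf \<mu> = {f \<in> borel_measurable \<mu>. \<exists>K. AE x in \<mu>. norm (f x) \<le> K}"

definition l1norm :: "'a measure \<Rightarrow> ('a \<Rightarrow> real) \<Rightarrow> ennreal" where
  "l1norm \<mu> f = (\<integral>\<^sup>+ x. ennreal \<bar>f x\<bar> \<partial>\<mu>)"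

text \<open>
  Additivity together with the norm bound forces \<open>T\<close> to respect almost-everywhere equality, so \<open>T\<close> is a
  bounded linear operator on the space of classes.
\<close>

definition L2_bounded_op :: "'a measure \<Rightarrow> (('a \<Rightarrow> complex) \<Rightarrow> ('a \<Rightarrow> complex)) \<Rightarrow> bool" where
  "L2_bounded_op \<mu> T \<longleftrightarrow>
     (\<forall>f\<in>L2 \<mu>. T f \<in> L2 \<mu>) \<and>
     (\<forall>f\<in>L2 \<mu>. \<forall>g\<in>L2 \<mu>. AE x in \<mu>. T (\<lambda>x. f x + g x) x = T f x + T g x) \<and>
     (\<forall>c. \<forall>f\<in>L2 \<mu>. AE x in \<mu>. T (\<lambda>x. c * f x) x = c * T f x) \<and>
     (\<exists>K. \<forall>f\<in>L2 \<mu>. l2norm \<mu> (T f) \<le> K * l2norm \<mu> f)"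

definition L2_adjoint ::
  "'a measure \<Rightarrow> (('a \<Rightarrow> complex) \<Rightarrow> ('a \<Rightarrow> complex)) \<Rightarrow> (('a \<Rightarrow> complex) \<Rightarrow> ('a \<Rightarrow> complex)) \<Rightarrow> bool" where
  "L2_adjoint \<mu> T S \<longleftrightarrow>
     (\<forall>g\<in>L2 \<mu>. S g \<in> L2 \<mu>) \<and>
     (\<forall>f\<in>L2 \<mu>. \<forall>g\<in>L2 \<mu>. l2inner \<mu> (T f) g = l2inner \<mu> f (S g))"

definition L2_compact_op :: "'a measure \<Rightarrow> (('a \<Rightarrow> complex) \<Rightarrow> ('a \<Rightarrow> complex)) \<Rightarrow> bool" where
  "L2_compact_op \<mu> T \<longleftrightarrow>
     (\<forall>F :: nat \<Rightarrow> 'a \<Rightarrow> complex. (\<forall>n. F n \<in> L2 \<mu> \<and> l2norm \<mu> (F n) \<le> 1) \<longrightarrow>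
        (\<exists>r g. strict_mono r \<and> g \<in> L2 \<mu> \<and>
           (\<lambda>n. l2norm \<mu> (\<lambda>x. T (F (r n)) x - g x)) \<longlonglongrightarrow> 0))"

definition L2_Linf_bounded :: "'a measure \<Rightarrow> (('a \<Rightarrow> complex) \<Rightarrow> ('a \<Rightarrow> complex)) \<Rightarrow> bool" where
  "L2_Linf_bounded \<mu> T \<longleftrightarrow> (\<exists>K. \<forall>f\<in>L2 \<mu>. AE x in \<mu>. norm (T f x) \<le> K * l2norm \<mu> f)"

definition positivity_preserving :: "'a measure \<Rightarrow> (('a \<Rightarrow> complex) \<Rightarrow> ('a \<Rightarrow> complex)) \<Rightarrow> bool" where
  "positivity_preserving \<mu> T \<longleftrightarrow>
     (\<forall>f\<in>L2 \<mu>. (AE x in \<mu>. 0 \<le> f x) \<longrightarrow> (AE x in \<mu>. 0 \<le> T f x))"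

definition positivity_improving :: "'a measure \<Rightarrow> (('a \<Rightarrow> complex) \<Rightarrow> ('a \<Rightarrow> complex)) \<Rightarrow> bool" where
  "positivity_improving \<mu> T \<longleftrightarrow>
     (\<forall>f\<in>L2 \<mu>. (AE x in \<mu>. 0 \<le> f x) \<and> \<not> (AE x in \<mu>. f x = 0) \<longrightarrow> (AE x in \<mu>. 0 < T f x))"

definition C0_semigroup :: "'a measure \<Rightarrow> (real \<Rightarrow> ('a \<Rightarrow> complex) \<Rightarrow> ('a \<Rightarrow> complex)) \<Rightarrow> bool" where
  "C0_semigroup \<mu> U \<longleftrightarrow>
     (\<forall>t\<ge>0. L2_bounded_op \<mu> (U t)) \<and>
     (\<forall>f\<in>L2 \<mu>. AE x in \<mu>. U 0 f x = f x) \<and>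
     (\<forall>s\<ge>0. \<forall>t\<ge>0. \<forall>f\<in>L2 \<mu>. AE x in \<mu>. U (s + t) f x = U s (U t f) x) \<and>
     (\<forall>f\<in>L2 \<mu>. \<forall>t\<ge>0. ((\<lambda>s. l2norm \<mu> (\<lambda>x. U s f x - U t f x)) \<longlongrightarrow> 0) (at t within {0..}))"

text \<open>
  Unbounded operators are given by their graphs: \<open>T f g\<close> means that \<open>f\<close> lies in the domain and that the
  operator maps \<open>f\<close> to \<open>g\<close>.
\<close>

definition generator ::
  "'a measure \<Rightarrow> (real \<Rightarrow> ('a \<Rightarrow> complex) \<Rightarrow> ('a \<Rightarrow> complex)) \<Rightarrow> ('a \<Rightarrow> complex) \<Rightarrow> ('a \<Rightarrow> complex) \<Rightarrow> bool" where
  "generator \<mu> U f g \<longleftrightarrow> f \<in> L2 \<mu> \<and> g \<in> L2 \<mu> \<and>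
     ((\<lambda>t. l2norm \<mu> (\<lambda>x. (U t f x - f x) / of_real t - g x)) \<longlongrightarrow> 0) (at_right 0)"

definition neg_op ::
  "(('a \<Rightarrow> complex) \<Rightarrow> ('a \<Rightarrow> complex) \<Rightarrow> bool) \<Rightarrow> ('a \<Rightarrow> complex) \<Rightarrow> ('a \<Rightarrow> complex) \<Rightarrow> bool" where
  "neg_op T f g \<longleftrightarrow> T f (\<lambda>x. - g x)"

text \<open>The norm bound in \<open>resolvent_set\<close> expresses both injectivity of \<open>z - T\<close> and boundedness of its inverse.\<close>

definition resolvent_set ::
  "'a measure \<Rightarrow> (('a \<Rightarrow> complex) \<Rightarrow> ('a \<Rightarrow> complex) \<Rightarrow> bool) \<Rightarrow> complex set" where
  "resolvent_set \<mu> T = {z.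
     (\<forall>h\<in>L2 \<mu>. \<exists>f g. T f g \<and> (AE x in \<mu>. z * f x - g x = h x)) \<and>
     (\<exists>K. \<forall>f g. T f g \<longrightarrow> l2norm \<mu> f \<le> K * l2norm \<mu> (\<lambda>x. z * f x - g x))}"

definition op_spectrum ::
  "'a measure \<Rightarrow> (('a \<Rightarrow> complex) \<Rightarrow> ('a \<Rightarrow> complex) \<Rightarrow> bool) \<Rightarrow> complex set" where
  "op_spectrum \<mu> T = - resolvent_set \<mu> T"

definition eigenfunction ::
  "'a measure \<Rightarrow> (('a \<Rightarrow> complex) \<Rightarrow> ('a \<Rightarrow> complex) \<Rightarrow> bool) \<Rightarrow> complex \<Rightarrow> ('a \<Rightarrow> complex) \<Rightarrow> bool" where
  "eigenfunction \<mu> T z f \<longleftrightarrow> T f (\<lambda>x. z * f x) \<and> \<not> (AE x in \<mu>. f x = 0)"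

definition kernel_op ::
  "'a measure \<Rightarrow> ('a \<Rightarrow> 'a \<Rightarrow> real) \<Rightarrow> ('a \<Rightarrow> 'b::{banach, second_countable_topology}) \<Rightarrow> 'a \<Rightarrow> 'b" where
  "kernel_op \<mu> k f x = (\<integral>y. k x y *\<^sub>R f y \<partial>\<mu>)"

definition L2_kernel ::
  "'a measure \<Rightarrow> (('a \<Rightarrow> complex) \<Rightarrow> ('a \<Rightarrow> complex)) \<Rightarrow> ('a \<Rightarrow> 'a \<Rightarrow> real) \<Rightarrow> bool" where
  "L2_kernel \<mu> T k \<longleftrightarrow>
     (\<forall>f\<in>L2 \<mu>. AE x in \<mu>. integrable \<mu> (\<lambda>y. k x y *\<^sub>R f y) \<and> T f x = kernel_op \<mu> k f x)"

text \<open>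
  The image of a bounded function under the kernel is a class modulo almost-everywhere equality; the strong
  Feller property asks this class to contain a bounded continuous function.
\<close>

definition strong_feller :: "'a::topological_space measure \<Rightarrow> ('a \<Rightarrow> 'a \<Rightarrow> real) \<Rightarrow> bool" where
  "strong_feller \<mu> k \<longleftrightarrow>
     (\<forall>f\<in>Linf \<mu>. (AE x in \<mu>. integrable \<mu> (\<lambda>y. k x y *\<^sub>R f y)) \<and>
        (\<exists>g\<in>bcontfun. AE x in \<mu>. kernel_op \<mu> k f x = g x))"

definition heat_content :: "'a measure \<Rightarrow> (real \<Rightarrow> 'a \<Rightarrow> 'a \<Rightarrow> real) \<Rightarrow> real \<Rightarrow> ennreal" where
  "heat_content \<mu> u t = (\<integral>\<^sup>+ x. ennreal (kernel_op \<mu> (u t) (\<lambda>_. 1 :: real) x) \<partial>\<mu>)"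

text \<open>
  A convention on extended reals relevant to statements about \<open>heat_content\<close> and \<open>l1norm\<close>:
  \<open>\<infinity> - \<infinity> = \<infinity>\<close> in \<open>ereal\<close>, hence a finite bound on \<open>\<bar>a - b\<bar>\<close> entails that \<open>a\<close> and \<open>b\<close> are finite
  when both are nonnegative.
\<close>

end

theory Submission
  imports Defs
begin

text \<open>
  Split \<open>U t = U t1 \<circ> U s \<circ> U t1\<close> with \<open>s = t - 2 t1\<close>. Formally the heat content is
  \<open>Z(t) = \<langle>U t 1, 1\<rangle> = \<langle>U s h, k\<rangle>\<close>, where \<open>h\<close> and \<open>k\<close> are the images of the constant \<open>1\<close> under \<open>U t1\<close>
  and its adjoint. Both have mass \<open>Z(t1) < \<infinity>\<close>. Since \<open>s > 2 t0\<close>, the kernel of \<open>exp (\<lambda>\<^sub>0 s) U s\<close> differs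
  from the rank-one kernel \<open>\<phi>\<^sub>0(x) \<psi>\<^sub>0(y) / \<Lambda>\<close> by at most a constant times \<open>exp (- \<gamma> s)\<close>, uniformly, and
  integrating against \<open>k\<close> and \<open>h\<close> costs only the factor \<open>Z(t1)\<^sup>2\<close>
  (\<open>bilinear_form_rank_one_estimate\<close>). The leading term is computed by duality:
  \<open>\<integral> \<phi>\<^sub>0 k = \<integral> U t1 \<phi>\<^sub>0 = exp (- \<lambda>\<^sub>0 t1) \<integral> \<phi>\<^sub>0\<close>, and likewise for \<open>\<psi>\<^sub>0\<close> and \<open>h\<close>; the exponentials cancel
  against \<open>exp (\<lambda>\<^sub>0 (t - s))\<close>. The same identity shows that the ground states are integrable, because they
  are bounded (\<open>smoothing_eigenfunction_bounded\<close>) while \<open>h\<close> and \<open>k\<close> are integrable.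

  The constant \<open>1\<close> is in general not square integrable, so the computation is made with the indicators of
  an increasing sequence of sets \<open>A n\<close> of finite measure that exhaust the space. For these every identity is
  an identity of inner products in \<open>L\<^sup>2\<close>, every estimate is uniform in \<open>n\<close>, and the compared quantities
  converge monotonically as \<open>n\<close> grows, by positivity (\<open>monotone_approximation_of_kernel_mass\<close>).

  That the semigroup acts on \<open>\<phi>\<^sub>0\<close> and its adjoint on \<open>\<psi>\<^sub>0\<close> as multiplication by \<open>exp (- \<lambda>\<^sub>0 t)\<close> is derived
  from the eigenvalue equations of the generators (\<open>eigenfunction_semigroup\<close>,
  \<open>eigenfunction_adjoint_semigroup\<close>) by solving a scalar differential equation with right derivatives.
\<close>


section \<open>Square integrable functions\<close>

lemma borel_measurable_cnj [measurable]:
  "f \<in> borel_measurable M \<Longrightarrow> (\<lambda>x. cnj (f x)) \<in> borel_measurable M"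
  by (rule borel_measurable_continuous_on[OF continuous_on_cnj[OF continuous_on_id]])

lemma L2_mult_integrable:
  assumes f: "f \<in> L2 \<mu>" and g: "g \<in> L2 \<mu>"
  shows "integrable \<mu> (\<lambda>x. norm (f x) * norm (g x))"
    and "integrable \<mu> (\<lambda>x. f x * cnj (g x))"
proof -
  have [measurable]: "f \<in> borel_measurable \<mu>" "g \<in> borel_measurable \<mu>"
    using f g by (auto simp: L2_def)
  have i: "integrable \<mu> (\<lambda>x. (norm (f x))\<^sup>2 + (norm (g x))\<^sup>2)"
    using f g by (auto simp: L2_def)
  have le: "\<bar>norm (f x) * norm (g x)\<bar> \<le> \<bar>(norm (f x))\<^sup>2 + (norm (g x))\<^sup>2\<bar>" for x
  proof -
    have "2 * (norm (f x) * norm (g x)) \<le> (norm (f x))\<^sup>2 + (norm (g x))\<^sup>2"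
      using sum_squares_bound[of "norm (f x)" "norm (g x)"] by (simp add: algebra_simps)
    moreover have "0 \<le> norm (f x) * norm (g x)" by simp
    ultimately show ?thesis by linarith
  qed
  show "integrable \<mu> (\<lambda>x. norm (f x) * norm (g x))"
    by (rule Bochner_Integration.integrable_bound[OF i]) (use le in \<open>auto simp: norm_mult\<close>)
  show "integrable \<mu> (\<lambda>x. f x * cnj (g x))"
    by (rule Bochner_Integration.integrable_bound[OF i]) (use le in \<open>auto simp: norm_mult\<close>)
qed

lemma L2_add:
  assumes f: "f \<in> L2 \<mu>" and g: "g \<in> L2 \<mu>"
  shows "(\<lambda>x. f x + g x) \<in> L2 \<mu>"
proof -
  have [measurable]: "f \<in> borel_measurable \<mu>" "g \<in> borel_measurable \<mu>"
    using f g by (auto simp: L2_def)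
  have i: "integrable \<mu> (\<lambda>x. 2 * (norm (f x))\<^sup>2 + 2 * (norm (g x))\<^sup>2)"
    using f g by (auto simp: L2_def)
  have "(norm (f x + g x))\<^sup>2 \<le> 2 * (norm (f x))\<^sup>2 + 2 * (norm (g x))\<^sup>2" for x
  proof -
    have "(norm (f x + g x))\<^sup>2 \<le> (norm (f x) + norm (g x))\<^sup>2"
      by (intro power_mono norm_triangle_ineq) auto
    then show ?thesis
      using sum_squares_bound[of "norm (f x)" "norm (g x)"] by (simp add: power2_sum)
  qed
  then have "integrable \<mu> (\<lambda>x. (norm (f x + g x))\<^sup>2)"
    by (intro Bochner_Integration.integrable_bound[OF i]) auto
  then show ?thesis by (simp add: L2_def)
qed

lemma L2_scale: "f \<in> L2 \<mu> \<Longrightarrow> (\<lambda>x. c * f x) \<in> L2 \<mu>"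
  by (auto simp: L2_def norm_mult power_mult_distrib)

lemma L2_diff: "f \<in> L2 \<mu> \<Longrightarrow> g \<in> L2 \<mu> \<Longrightarrow> (\<lambda>x. f x - g x) \<in> L2 \<mu>"
  using L2_add[of f \<mu> "\<lambda>x. (-1) * g x"] L2_scale[of g \<mu> "-1"] by simp

lemma L2_bound:
  assumes f: "f \<in> L2 \<mu>" and "g \<in> borel_measurable \<mu>" and "\<And>x. norm (g x) \<le> norm (f x)"
  shows "g \<in> L2 \<mu>"
proof -
  have "integrable \<mu> (\<lambda>x. (norm (f x))\<^sup>2)" using f by (simp add: L2_def)
  then have "integrable \<mu> (\<lambda>x. (norm (g x))\<^sup>2)"
    by (rule Bochner_Integration.integrable_bound) (use assms in \<open>auto intro!: power_mono\<close>)
  then show ?thesis using assms by (simp add: L2_def)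
qed

lemma measurable_of_complex_L2:
  assumes "(\<lambda>x. of_real (f x)) \<in> L2 \<mu>" shows "f \<in> borel_measurable \<mu>"
proof -
  have "(\<lambda>x. complex_of_real (f x)) \<in> borel_measurable \<mu>" using assms by (simp add: L2_def)
  then have "(\<lambda>x. Re (complex_of_real (f x))) \<in> borel_measurable \<mu>" by measurable
  then show ?thesis by simp
qed

lemma L2_indicator:
  assumes "S \<in> sets \<mu>" "emeasure \<mu> S \<noteq> \<infinity>"
  shows "indicator S \<in> L2 \<mu>"
proof -
  have "(norm (indicator S x :: complex))\<^sup>2 = indicator S x" for x
    by (auto simp: indicator_def)
  then show ?thesis using assms by (auto simp: L2_def less_top)
qed

text \<open>
  The quadratic polynomial \<open>c \<mapsto> \<integral>(c |f| + |g|)\<^sup>2\<close> is nonnegative, so its discriminant is not positive.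
\<close>

lemma l2inner_Cauchy_Schwarz:
  assumes f: "f \<in> L2 \<mu>" and g: "g \<in> L2 \<mu>"
  shows "norm (l2inner \<mu> f g) \<le> l2norm \<mu> f * l2norm \<mu> g"
proof -
  let ?A = "\<integral>x. (norm (f x))\<^sup>2 \<partial>\<mu>" and ?B = "\<integral>x. norm (f x) * norm (g x) \<partial>\<mu>"
    and ?D = "\<integral>x. (norm (g x))\<^sup>2 \<partial>\<mu>"
  have int: "integrable \<mu> (\<lambda>x. (norm (f x))\<^sup>2)" "integrable \<mu> (\<lambda>x. (norm (g x))\<^sup>2)"
    using f g by (auto simp: L2_def)
  note intfg = L2_mult_integrable(1)[OF f g]
  have quad: "0 \<le> c\<^sup>2 * ?A + 2 * c * ?B + ?D" for c
  proof -
    have "0 \<le> (\<integral>x. (c * norm (f x) + norm (g x))\<^sup>2 \<partial>\<mu>)" by (rule integral_nonneg_AE) auto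
    also have "\<dots> = (\<integral>x. c\<^sup>2 * (norm (f x))\<^sup>2 + (2 * c) * (norm (f x) * norm (g x)) + (norm (g x))\<^sup>2 \<partial>\<mu>)"
      by (simp add: power2_sum power_mult_distrib algebra_simps)
    also have "\<dots> = c\<^sup>2 * ?A + (2 * c) * ?B + ?D"
      using int intfg by simp
    finally show ?thesis by simp
  qed
  have B0: "0 \<le> ?B" by (rule integral_nonneg_AE) auto
  have A0: "0 \<le> ?A" by (rule integral_nonneg_AE) auto
  have "?B\<^sup>2 \<le> ?A * ?D"
  proof (cases "?A = 0")
    case True
    have "?B = 0"
    proof (rule ccontr)
      assume "?B \<noteq> 0"
      then show False using quad[of "- (?D + 1) / (2 * ?B)"] True by (simp add: field_simps)
    qed
    then show ?thesis using True by simp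
  next
    case False
    then have "0 < ?A" using A0 by linarith
    then show ?thesis using quad[of "- ?B / ?A"] by (simp add: field_simps power2_eq_square)
  qed
  then have "?B \<le> l2norm \<mu> f * l2norm \<mu> g"
    unfolding l2norm_def real_sqrt_mult[symmetric] using B0 real_le_rsqrt by blast
  moreover have "norm (l2inner \<mu> f g) \<le> ?B"
    unfolding l2inner_def
    using integral_norm_bound[of \<mu> "\<lambda>x. f x * cnj (g x)"] by (simp add: norm_mult)
  ultimately show ?thesis by linarith
qed

lemma l2inner_cnj: "l2inner \<mu> g f = cnj (l2inner \<mu> f g)"
proof -
  have "(\<integral>x. cnj (f x * cnj (g x)) \<partial>\<mu>) = cnj (l2inner \<mu> f g)"
    unfolding l2inner_def by (rule Bochner_Integration.integral_cnj)
  then show ?thesis by (simp add: l2inner_def mult.commute)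
qed

lemma l2inner_diff:
  assumes "f \<in> L2 \<mu>" "g \<in> L2 \<mu>" "h \<in> L2 \<mu>"
  shows "l2inner \<mu> (\<lambda>x. f x - g x) h = l2inner \<mu> f h - l2inner \<mu> g h"
  using assms by (simp add: l2inner_def left_diff_distrib L2_mult_integrable)

lemma l2inner_scale: "l2inner \<mu> (\<lambda>x. c * f x) h = c * l2inner \<mu> f h"
  by (simp add: l2inner_def mult.assoc)

lemma l2inner_eq_imp_AE_eq:
  assumes f: "f \<in> L2 \<mu>" and g: "g \<in> L2 \<mu>"
    and eq: "\<And>h. h \<in> L2 \<mu> \<Longrightarrow> l2inner \<mu> f h = l2inner \<mu> g h"
  shows "AE x in \<mu>. f x = g x"
proof -
  let ?d = "\<lambda>x. f x - g x"
  have d: "?d \<in> L2 \<mu>" using f g by (rule L2_diff)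
  have "0 = l2inner \<mu> ?d ?d" using eq[OF d] l2inner_diff[OF f g d] by simp
  also have "\<dots> = (\<integral>x. of_real ((norm (?d x))\<^sup>2) \<partial>\<mu>)"
    unfolding l2inner_def by (intro Bochner_Integration.integral_cong refl)
      (simp only: complex_norm_square)
  finally have "(\<integral>x. (norm (?d x))\<^sup>2 \<partial>\<mu>) = 0"
    by (metis integral_complex_of_real of_real_eq_0_iff)
  then have "AE x in \<mu>. (norm (?d x))\<^sup>2 = 0"
    using d by (subst (asm) integral_nonneg_eq_0_iff_AE) (auto simp: L2_def)
  then show ?thesis by auto
qed

lemma l2inner_AE_cong_left:
  assumes "AE x in \<mu>. f x = f' x" "f \<in> L2 \<mu>" "f' \<in> L2 \<mu>" "g \<in> L2 \<mu>"
  shows "l2inner \<mu> f g = l2inner \<mu> f' g"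
proof -
  have [measurable]: "f \<in> borel_measurable \<mu>" "f' \<in> borel_measurable \<mu>" "g \<in> borel_measurable \<mu>"
    using assms by (auto simp: L2_def)
  show ?thesis
    unfolding l2inner_def using assms(1) by (intro integral_cong_AE) auto
qed

section \<open>Right derivatives and exponential decay\<close>

text \<open>
  Orbits of a semigroup are known to be differentiable from the right only, so the usual mean value
  theorem does not apply. Instead, for every slope \<open>e > 0\<close> one takes the last time \<open>s \<le> T\<close> at which
  \<open>|F s - F a| \<le> e (s - a)\<close>; if \<open>s < T\<close>, the vanishing right derivative at \<open>s\<close> would produce a later
  such time. Hence the bound holds at \<open>T\<close> for every \<open>e\<close>.
\<close>

lemma zero_right_derivative_imp_constant:
  fixes F :: "real \<Rightarrow> 'a::real_normed_vector"
  assumes cont: "continuous_on {a..} F"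
    and deriv: "\<And>t. a \<le> t \<Longrightarrow> ((\<lambda>s. (1 / (s - t)) *\<^sub>R (F s - F t)) \<longlongrightarrow> 0) (at_right t)"
    and T: "a \<le> T"
  shows "F T = F a"
proof -
  have bound: "norm (F T - F a) \<le> e * (T - a)" if e: "0 < e" for e
  proof (rule ccontr)
    let ?G = "\<lambda>t. norm (F t - F a) - e * (t - a)"
    assume "\<not> ?thesis"
    then have GT: "0 < ?G T" by simp
    define S where "S = {t \<in> {a..T}. ?G t \<le> 0}"
    have contG: "continuous_on {a..T} ?G"
      by (intro continuous_intros continuous_on_subset[OF cont]) auto
    have "closed S"
      unfolding S_def using continuous_closed_preimage[OF contG closed_atLeastAtMost closed_atMost[of 0]]
      by (simp add: vimage_def Int_def)
    then have "compact S"
      unfolding compact_eq_bounded_closed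
      using bounded_subset[OF bounded_closed_interval[of a T], of S]
      by (metis (no_types, lifting) S_def mem_Collect_eq subsetI)
    moreover have "a \<in> S" using T by (simp add: S_def)
    \<comment> \<open>Compactness provides the last time at which the bound of slope \<open>e\<close> holds.\<close>
    ultimately obtain s where s: "s \<in> S" and max: "\<And>t. t \<in> S \<Longrightarrow> t \<le> s"
      using compact_attains_sup[of S] by blast
    have sT: "a \<le> s" "s < T" "?G s \<le> 0"
      using s GT unfolding S_def by (auto simp: order_le_less)
    have "eventually (\<lambda>t. norm ((1 / (t - s)) *\<^sub>R (F t - F s)) < e) (at_right s)"
      using tendstoD[OF deriv[OF sT(1)] e] by simp
    moreover have "eventually (\<lambda>t. t \<in> {s<..<T}) (at_right s)"
      using sT(2) by (rule eventually_at_right_real)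
    ultimately have "eventually (\<lambda>t. norm ((1 / (t - s)) *\<^sub>R (F t - F s)) < e \<and> t \<in> {s<..<T}) (at_right s)"
      by (rule eventually_conj)
    then obtain t where t: "norm ((1 / (t - s)) *\<^sub>R (F t - F s)) < e" "s < t" "t < T"
      by (metis (no_types, lifting) eventually_happens greaterThanLessThan_iff trivial_limit_at_right_real)
    have "norm (F t - F s) < e * (t - s)"
      using t by (simp add: pos_divide_less_eq)
    moreover have "norm (F t - F a) \<le> norm (F t - F s) + norm (F s - F a)"
      using norm_triangle_ineq[of "F t - F s" "F s - F a"] by simp
    ultimately have "?G t \<le> 0" using sT(3) by (simp add: algebra_simps)
    then have "t \<in> S" using t sT by (simp add: S_def)
    then show False using max t(2) by force
  qed
  have "norm (F T - F a) \<le> 0"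
  proof (rule field_le_epsilon)
    fix e :: real assume "0 < e"
    then have "norm (F T - F a) \<le> e / (T - a + 1) * (T - a)"
      using T by (intro bound) simp
    also have "\<dots> \<le> e" using \<open>0 < e\<close> T by (simp add: field_simps)
    finally show "norm (F T - F a) \<le> 0 + e" by simp
  qed
  then show ?thesis by simp
qed

text \<open>
  The function \<open>exp (- c t) P t\<close> has vanishing right derivative.
\<close>

lemma exponential_of_right_derivative:
  fixes P :: "real \<Rightarrow> complex" and c :: real
  assumes cont: "continuous_on {0..} P"
    and deriv: "\<And>t. 0 \<le> t \<Longrightarrow> ((\<lambda>h. (P (t + h) - P t) / of_real h) \<longlongrightarrow> of_real c * P t) (at_right 0)"
    and T: "0 \<le> T"
  shows "P T = of_real (exp (c * T)) * P 0"
proof -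
  define F where "F t = exp (- c * t) *\<^sub>R P t" for t
  have "F T = F 0"
  proof (rule zero_right_derivative_imp_constant[OF _ _ T])
    show "continuous_on {0..} F"
      unfolding F_def by (intro continuous_intros cont)
    fix t :: real assume t: "0 \<le> t"
    have "((\<lambda>h. exp (- c * (t + h)) *\<^sub>R ((P (t + h) - P t) / of_real h)
            + ((exp (- c * (t + h)) - exp (- c * t)) / h) *\<^sub>R P t) \<longlongrightarrow>
          exp (- c * t) *\<^sub>R (of_real c * P t) + (exp (- c * t) * - c) *\<^sub>R P t) (at_right 0)"
    proof (intro tendsto_add tendsto_scaleR deriv[OF t] tendsto_const)
      show "((\<lambda>h. exp (- c * (t + h))) \<longlongrightarrow> exp (- c * t)) (at_right 0)"
        by (auto intro!: tendsto_eq_intros)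
      have "((\<lambda>t. exp (- c * t)) has_real_derivative exp (- c * t) * - c) (at t)"
        by (auto intro!: derivative_eq_intros)
      then show "((\<lambda>h. (exp (- c * (t + h)) - exp (- c * t)) / h) \<longlongrightarrow> exp (- c * t) * - c) (at_right 0)"
        unfolding DERIV_def by (rule tendsto_mono[rotated]) (simp add: at_le)
    qed
    moreover have "exp (- c * (t + h)) *\<^sub>R ((P (t + h) - P t) / of_real h)
            + ((exp (- c * (t + h)) - exp (- c * t)) / h) *\<^sub>R P t = (1 / h) *\<^sub>R (F (t + h) - F t)" for h
      unfolding F_def scaleR_conv_of_real by (cases "h = 0") (auto simp: field_simps)
    ultimately have "((\<lambda>h. (1 / h) *\<^sub>R (F (t + h) - F t)) \<longlongrightarrow> 0) (at_right 0)"
      by (simp add: scaleR_conv_of_real mult.assoc)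
    then show "((\<lambda>s. (1 / (s - t)) *\<^sub>R (F s - F t)) \<longlongrightarrow> 0) (at_right t)"
      by (simp add: at_right_to_0[of t] filterlim_filtermap add.commute)
  qed
  then have "exp (- c * T) *\<^sub>R P T = P 0" by (simp add: F_def)
  then have "exp (c * T) *\<^sub>R P 0 = (exp (c * T) * exp (- c * T)) *\<^sub>R P T" by (metis scaleR_scaleR)
  also have "exp (c * T) * exp (- c * T) = 1" by (simp flip: exp_add)
  finally show ?thesis by (simp add: scaleR_conv_of_real)
qed


section \<open>The semigroup on the ground states\<close>

text \<open>
  Pairing with a fixed \<open>g\<close> turns the norm limit in the definition of the generator into a scalar right
  derivative at zero. The family \<open>V\<close> is arbitrary, because the lemma serves the semigroup and its adjoint alike.
\<close>

lemma generator_weak_right_derivative: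
  assumes gen: "generator \<mu> V f w" and V: "\<And>h. 0 \<le> h \<Longrightarrow> V h f \<in> L2 \<mu>" and g: "g \<in> L2 \<mu>"
  shows "((\<lambda>h. (l2inner \<mu> (V h f) g - l2inner \<mu> f g) / of_real h) \<longlongrightarrow> l2inner \<mu> w g) (at_right 0)"
proof -
  let ?D = "\<lambda>h x. (V h f x - f x) / of_real h - w x"
  have f: "f \<in> L2 \<mu>" and w: "w \<in> L2 \<mu>"
    and lim: "((\<lambda>h. l2norm \<mu> (?D h)) \<longlongrightarrow> 0) (at_right 0)"
    using gen by (auto simp: generator_def)
  have "((\<lambda>h. (l2inner \<mu> (V h f) g - l2inner \<mu> f g) / of_real h - l2inner \<mu> w g) \<longlongrightarrow> 0) (at_right 0)"
  proof (rule Lim_null_comparison)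
    show "((\<lambda>h. l2norm \<mu> (?D h) * l2norm \<mu> g) \<longlongrightarrow> 0) (at_right 0)"
      using tendsto_mult_right[OF lim, of "l2norm \<mu> g"] by simp
    show "\<forall>\<^sub>F h in at_right 0. norm ((l2inner \<mu> (V h f) g - l2inner \<mu> f g) / of_real h - l2inner \<mu> w g)
        \<le> l2norm \<mu> (?D h) * l2norm \<mu> g"
      using eventually_at_right_less[of 0]
    proof (rule eventually_mono)
      fix h :: real assume h: "0 < h"
      have dq: "(\<lambda>x. inverse (of_real h) * (V h f x - f x)) \<in> L2 \<mu>"
        using h f V[of h] by (intro L2_scale L2_diff) auto
      have eq: "?D h = (\<lambda>x. inverse (of_real h) * (V h f x - f x) - w x)"
        by (simp add: field_simps)
      have "l2inner \<mu> (?D h) g = (l2inner \<mu> (V h f) g - l2inner \<mu> f g) / of_real h - l2inner \<mu> w g"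
        unfolding eq using h f w g V[of h] dq
        by (simp add: l2inner_diff l2inner_scale divide_inverse mult.commute)
      moreover have "?D h \<in> L2 \<mu>" unfolding eq by (rule L2_diff[OF dq w])
      ultimately show "norm ((l2inner \<mu> (V h f) g - l2inner \<mu> f g) / of_real h - l2inner \<mu> w g)
        \<le> l2norm \<mu> (?D h) * l2norm \<mu> g"
        using l2inner_Cauchy_Schwarz[OF _ g] by metis
    qed
  qed
  then show ?thesis by (simp add: LIM_zero_cancel)
qed

lemma C0_semigroup_L2: "C0_semigroup \<mu> U \<Longrightarrow> 0 \<le> t \<Longrightarrow> f \<in> L2 \<mu> \<Longrightarrow> U t f \<in> L2 \<mu>"
  by (auto simp: C0_semigroup_def L2_bounded_op_def)

lemma C0_semigroup_weak_add:
  assumes "C0_semigroup \<mu> U" "0 \<le> s" "0 \<le> t" "f \<in> L2 \<mu>" "g \<in> L2 \<mu>"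
  shows "l2inner \<mu> (U (s + t) f) g = l2inner \<mu> (U s (U t f)) g"
  using assms by (intro l2inner_AE_cong_left) (auto simp: C0_semigroup_L2, auto simp: C0_semigroup_def)

lemma C0_semigroup_weak_continuous:
  assumes sg: "C0_semigroup \<mu> U" and f: "f \<in> L2 \<mu>" and g: "g \<in> L2 \<mu>"
  shows "continuous_on {0..} (\<lambda>t. l2inner \<mu> (U t f) g)"
  unfolding continuous_on
proof
  fix t :: real assume t: "t \<in> {0..}"
  have lim: "((\<lambda>s. l2norm \<mu> (\<lambda>x. U s f x - U t f x)) \<longlongrightarrow> 0) (at t within {0..})"
    using sg f t by (auto simp: C0_semigroup_def)
  have "((\<lambda>s. l2inner \<mu> (U s f) g - l2inner \<mu> (U t f) g) \<longlongrightarrow> 0) (at t within {0..})"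
  proof (rule Lim_null_comparison)
    show "((\<lambda>s. l2norm \<mu> (\<lambda>x. U s f x - U t f x) * l2norm \<mu> g) \<longlongrightarrow> 0) (at t within {0..})"
      using tendsto_mult_right[OF lim, of "l2norm \<mu> g"] by simp
    have "\<forall>\<^sub>F s in at t within {0..}. s \<in> {0..}" by (simp add: eventually_at_filter)
    then show "\<forall>\<^sub>F s in at t within {0..}. norm (l2inner \<mu> (U s f) g - l2inner \<mu> (U t f) g)
        \<le> l2norm \<mu> (\<lambda>x. U s f x - U t f x) * l2norm \<mu> g"
    proof (rule eventually_mono)
      fix s :: real assume "s \<in> {0..}"
      then have "U s f \<in> L2 \<mu>" "U t f \<in> L2 \<mu>" using sg t f by (auto intro: C0_semigroup_L2)
      then show "norm (l2inner \<mu> (U s f) g - l2inner \<mu> (U t f) g)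
        \<le> l2norm \<mu> (\<lambda>x. U s f x - U t f x) * l2norm \<mu> g"
        using l2inner_Cauchy_Schwarz[OF L2_diff g] l2inner_diff[OF _ _ g] by metis
    qed
  qed
  then show "((\<lambda>s. l2inner \<mu> (U s f) g) \<longlongrightarrow> l2inner \<mu> (U t f) g) (at t within {0..})"
    by (simp add: LIM_zero_cancel)
qed

lemma L2_adjointD:
  assumes "L2_adjoint \<mu> T S"
  shows "g \<in> L2 \<mu> \<Longrightarrow> S g \<in> L2 \<mu>"
    and "f \<in> L2 \<mu> \<Longrightarrow> g \<in> L2 \<mu> \<Longrightarrow> l2inner \<mu> (T f) g = l2inner \<mu> f (S g)"
  using assms by (auto simp: L2_adjoint_def)

lemma C0_semigroup_weak_0:
  assumes "C0_semigroup \<mu> U" "f \<in> L2 \<mu>" "g \<in> L2 \<mu>"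
  shows "l2inner \<mu> (U 0 f) g = l2inner \<mu> f g"
  using assms by (intro l2inner_AE_cong_left) (auto simp: C0_semigroup_L2, auto simp: C0_semigroup_def)

text \<open>
  The scalar function \<open>r \<mapsto> \<langle>U r f, g\<rangle>\<close> has right derivative \<open>- c \<langle>U r f, g\<rangle>\<close> at every \<open>r\<close>: moving
  \<open>U r\<close> to the other side as \<open>Us r g\<close> reduces this to the derivative at zero. Working weakly, with one
  fixed pair \<open>f, g\<close>, avoids any uniform bound on the operators \<open>U r\<close>.
\<close>

lemma eigenfunction_semigroup:
  fixes c :: real
  assumes sg: "C0_semigroup \<mu> U" and adj: "\<forall>t\<ge>0. L2_adjoint \<mu> (U t) (Us t)"
    and eig: "eigenfunction \<mu> (neg_op (generator \<mu> U)) (of_real c) f"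
    and t: "0 \<le> t" and g: "g \<in> L2 \<mu>"
  shows "l2inner \<mu> (U t f) g = of_real (exp (- c * t)) * l2inner \<mu> f g"
proof -
  have gen: "generator \<mu> U f (\<lambda>x. of_real (- c) * f x)"
    using eig by (simp add: eigenfunction_def neg_op_def)
  then have f: "f \<in> L2 \<mu>" by (simp add: generator_def)
  have "l2inner \<mu> (U t f) g = of_real (exp (- c * t)) * l2inner \<mu> (U 0 f) g"
  proof (rule exponential_of_right_derivative[OF C0_semigroup_weak_continuous[OF sg f g] _ t])
    fix r :: real assume r: "0 \<le> r"
    have Usg: "Us r g \<in> L2 \<mu>" using adj r g by (auto intro: L2_adjointD)
    have shift: "l2inner \<mu> (U (r + h) f) g = l2inner \<mu> (U h f) (Us r g)" if "0 \<le> h" for h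
      using C0_semigroup_weak_add[OF sg r that f g] adj r g C0_semigroup_L2[OF sg that f]
      by (auto simp: L2_adjointD)
    have base: "l2inner \<mu> (U r f) g = l2inner \<mu> f (Us r g)"
      by (rule L2_adjointD(2)[OF adj[rule_format, OF r] f g])
    have "((\<lambda>h. (l2inner \<mu> (U h f) (Us r g) - l2inner \<mu> f (Us r g)) / of_real h)
        \<longlongrightarrow> of_real (- c) * l2inner \<mu> (U r f) g) (at_right 0)"
      using generator_weak_right_derivative[OF gen C0_semigroup_L2[OF sg _ f] Usg]
      unfolding l2inner_scale by (simp add: base)
    then show "((\<lambda>h. (l2inner \<mu> (U (r + h) f) g - l2inner \<mu> (U r f) g) / of_real h)
        \<longlongrightarrow> of_real (- c) * l2inner \<mu> (U r f) g) (at_right 0)"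
      by (rule Lim_transform_eventually)
        (use eventually_at_right_less[of 0] in \<open>rule eventually_mono\<close>,
          simp add: shift base)
  qed
  then show ?thesis by (simp add: C0_semigroup_weak_0[OF sg f g])
qed

text \<open>
  The pairings \<open>\<langle>Us r f, g\<rangle>\<close> are conjugates of \<open>\<langle>U r g, f\<rangle>\<close>, so continuity in \<open>r\<close> and the semigroup law,
  both in the weak sense, are inherited from \<open>U\<close>; the scalar differential equation is then the same.
\<close>

lemma eigenfunction_adjoint_semigroup:
  fixes c :: real
  assumes sg: "C0_semigroup \<mu> U" and adj: "\<forall>t\<ge>0. L2_adjoint \<mu> (U t) (Us t)"
    and eig: "eigenfunction \<mu> (neg_op (generator \<mu> Us)) (of_real c) f"
    and t: "0 \<le> t" and g: "g \<in> L2 \<mu>"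
  shows "l2inner \<mu> (Us t f) g = of_real (exp (- c * t)) * l2inner \<mu> f g"
proof -
  have gen: "generator \<mu> Us f (\<lambda>x. of_real (- c) * f x)"
    using eig by (simp add: eigenfunction_def neg_op_def)
  then have f: "f \<in> L2 \<mu>" by (simp add: generator_def)
  have UsL2: "Us r f \<in> L2 \<mu>" if "0 \<le> r" for r using adj that f by (auto intro: L2_adjointD)
  have flip: "l2inner \<mu> (Us r f) k = cnj (l2inner \<mu> (U r k) f)" if "0 \<le> r" "k \<in> L2 \<mu>" for r k
    using adj that f L2_adjointD(2)[of \<mu> "U r" "Us r" k f] by (simp add: l2inner_cnj[of _ "Us r f"])
  have "l2inner \<mu> (Us t f) g = of_real (exp (- c * t)) * l2inner \<mu> (Us 0 f) g"
  proof (rule exponential_of_right_derivative[OF _ _ t])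
    have "continuous_on {0..} (\<lambda>t. cnj (l2inner \<mu> (U t g) f))"
      by (intro continuous_intros C0_semigroup_weak_continuous[OF sg g f])
    then show "continuous_on {0..} (\<lambda>t. l2inner \<mu> (Us t f) g)"
      by (rule continuous_on_eq) (simp add: flip g)
    fix r :: real assume r: "0 \<le> r"
    have Ug: "U r g \<in> L2 \<mu>" by (rule C0_semigroup_L2[OF sg r g])
    have shift: "l2inner \<mu> (Us (r + h) f) g = l2inner \<mu> (Us h f) (U r g)" if "0 \<le> h" for h
      using C0_semigroup_weak_add[OF sg that r g f] r that g Ug by (simp add: flip add.commute)
    have base: "l2inner \<mu> (Us r f) g = l2inner \<mu> f (U r g)"
      using r g by (simp add: flip l2inner_cnj[of _ f])
    have "((\<lambda>h. (l2inner \<mu> (Us h f) (U r g) - l2inner \<mu> f (U r g)) / of_real h)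
        \<longlongrightarrow> of_real (- c) * l2inner \<mu> (Us r f) g) (at_right 0)"
      using generator_weak_right_derivative[OF gen UsL2 Ug]
      unfolding l2inner_scale base by simp
    then show "((\<lambda>h. (l2inner \<mu> (Us (r + h) f) g - l2inner \<mu> (Us r f) g) / of_real h)
        \<longlongrightarrow> of_real (- c) * l2inner \<mu> (Us r f) g) (at_right 0)"
      by (rule Lim_transform_eventually)
        (use eventually_at_right_less[of 0] in \<open>rule eventually_mono\<close>, simp add: shift base)
  qed
  also have "l2inner \<mu> (Us 0 f) g = l2inner \<mu> f g"
    using C0_semigroup_weak_0[OF sg g f] g by (simp add: flip l2inner_cnj[of _ f])
  finally show ?thesis .
qed

text \<open>
  An eigenfunction is a multiple of its own image, and images are bounded.
\<close>

lemma smoothing_eigenfunction_bounded: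
  assumes smooth: "L2_Linf_bounded \<mu> T" and f: "f \<in> L2 \<mu>" and Tf: "T f \<in> L2 \<mu>"
    and eig: "\<And>g. g \<in> L2 \<mu> \<Longrightarrow> l2inner \<mu> (T f) g = c * l2inner \<mu> f g" and c: "c \<noteq> 0"
  obtains K where "0 \<le> K" "AE x in \<mu>. norm (f x) \<le> K"
proof -
  have ae: "AE x in \<mu>. T f x = c * f x"
    using l2inner_eq_imp_AE_eq[OF Tf L2_scale[OF f, of c]] eig by (simp add: l2inner_scale)
  obtain K where K: "AE x in \<mu>. norm (T f x) \<le> K * l2norm \<mu> f"
    using smooth f by (auto simp: L2_Linf_bounded_def)
  have "AE x in \<mu>. norm (f x) \<le> max 0 (K * l2norm \<mu> f / norm c)"
    using ae K
  proof eventually_elim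
    case (elim x)
    then have "norm c * norm (f x) \<le> K * l2norm \<mu> f" by (simp add: norm_mult)
    then have "norm (f x) \<le> K * l2norm \<mu> f / norm c"
      using c by (simp add: pos_le_divide_eq mult.commute)
    then show ?case by simp
  qed
  then show ?thesis by (intro that[of "max 0 (K * l2norm \<mu> f / norm c)"]) auto
qed


section \<open>Positivity and exhaustion by sets of finite measure\<close>

lemma sigma_finite_of_locally_finite:
  fixes \<mu> :: "'a::second_countable_topology measure"
  assumes borel: "sets \<mu> = sets borel"
    and fin: "\<forall>x. \<exists>V. open V \<and> x \<in> V \<and> emeasure \<mu> V < \<infinity>"
  shows "sigma_finite_measure \<mu>"
proof -
  obtain F where F: "F \<subseteq> {V. open V \<and> emeasure \<mu> V < \<infinity>}" "countable F"
      "\<Union>F = \<Union>{V. open V \<and> emeasure \<mu> V < \<infinity>}"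
    using Lindelof[of "{V. open V \<and> emeasure \<mu> V < \<infinity>}"] by auto
  show ?thesis
  proof
    show "\<exists>A. countable A \<and> A \<subseteq> sets \<mu> \<and> \<Union> A = space \<mu> \<and> (\<forall>a\<in>A. emeasure \<mu> a \<noteq> \<infinity>)"
    proof (intro exI[of _ F] conjI)
      show "F \<subseteq> sets \<mu>" using F(1) borel by auto
      show "\<Union>F = space \<mu>"
        using F(3) fin sets_eq_imp_space_eq[OF borel] by auto
      show "countable F" by (rule F(2))
      show "\<forall>a\<in>F. emeasure \<mu> a \<noteq> \<infinity>" using F(1) by (auto simp: less_top)
    qed
  qed
qed

lemma l2inner_real:
  fixes a b :: "'a \<Rightarrow> real"
  assumes "f \<in> L2 \<mu>" "g \<in> L2 \<mu>" "AE x in \<mu>. f x = of_real (a x)" "AE x in \<mu>. g x = of_real (b x)"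
    and [measurable]: "a \<in> borel_measurable \<mu>" "b \<in> borel_measurable \<mu>"
  shows "l2inner \<mu> f g = of_real (\<integral>x. a x * b x \<partial>\<mu>)" and "integrable \<mu> (\<lambda>x. a x * b x)"
proof -
  have [measurable]: "f \<in> borel_measurable \<mu>" "g \<in> borel_measurable \<mu>"
    using assms by (auto simp: L2_def)
  have ae: "AE x in \<mu>. f x * cnj (g x) = of_real (a x * b x)"
    using assms(3,4) by eventually_elim simp
  have "l2inner \<mu> f g = (\<integral>x. of_real (a x * b x) \<partial>\<mu>)"
    unfolding l2inner_def using ae by (intro integral_cong_AE) auto
  then show "l2inner \<mu> f g = of_real (\<integral>x. a x * b x \<partial>\<mu>)"
    by (simp only: integral_complex_of_real)
  have "integrable \<mu> (\<lambda>x. complex_of_real (a x * b x))"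
    by (rule iffD1[OF integrable_cong_AE L2_mult_integrable(2)[OF assms(1,2)]]) (use ae in auto)
  from integrable_Re[OF this] show "integrable \<mu> (\<lambda>x. a x * b x)" by simp
qed

text \<open>
  Testing against the negative part \<open>f\<close> of \<open>r\<close> gives \<open>0 \<le> - \<integral> f\<^sup>2\<close>.
\<close>

lemma AE_nonneg_by_testing:
  fixes r :: "'a \<Rightarrow> real"
  assumes r: "(\<lambda>x. of_real (r x)) \<in> L2 \<mu>"
    and test: "\<And>f. (\<lambda>x. of_real (f x)) \<in> L2 \<mu> \<Longrightarrow> (\<And>x. 0 \<le> f x) \<Longrightarrow> 0 \<le> (\<integral>x. f x * r x \<partial>\<mu>)"
  shows "AE x in \<mu>. 0 \<le> r x"
proof -
  define f where "f x = max 0 (- r x)" for x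
  have [measurable]: "r \<in> borel_measurable \<mu>" by (rule measurable_of_complex_L2[OF r])
  have fL: "(\<lambda>x. of_real (f x)) \<in> L2 \<mu>"
    by (rule L2_bound[OF r]) (auto simp: f_def)
  have fr: "f x * r x = - (f x)\<^sup>2" for x by (simp add: f_def max_def power2_eq_square)
  have int: "integrable \<mu> (\<lambda>x. (f x)\<^sup>2)" using fL by (simp add: L2_def)
  have "0 \<le> (\<integral>x. f x * r x \<partial>\<mu>)" by (rule test[OF fL]) (simp add: f_def)
  then have "(\<integral>x. (f x)\<^sup>2 \<partial>\<mu>) \<le> 0" by (simp add: fr)
  moreover have "0 \<le> (\<integral>x. (f x)\<^sup>2 \<partial>\<mu>)" by simp
  ultimately have "(\<integral>x. (f x)\<^sup>2 \<partial>\<mu>) = 0" by linarith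
  then have "AE x in \<mu>. (f x)\<^sup>2 = 0"
    by (subst (asm) integral_nonneg_eq_0_iff_AE[OF int]) auto
  then show ?thesis by eventually_elim (auto simp: f_def max_def split: if_splits)
qed

text \<open>
  By duality \<open>\<langle>f, S g\<rangle> = \<langle>T f, g\<rangle> \<ge> 0\<close> for all \<open>f \<ge> 0\<close>. Real and imaginary part of \<open>S g\<close> are then tested
  separately; the imaginary part passes with both signs and hence vanishes.
\<close>

lemma adjoint_positivity_preserving:
  assumes adj: "L2_adjoint \<mu> T S" and pos: "positivity_preserving \<mu> T"
    and T: "\<And>f. f \<in> L2 \<mu> \<Longrightarrow> T f \<in> L2 \<mu>"
  shows "positivity_preserving \<mu> S"
  unfolding positivity_preserving_def
proof (intro ballI impI)
  fix g assume g: "g \<in> L2 \<mu>" and g0: "AE x in \<mu>. 0 \<le> g x"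
  have Sg: "S g \<in> L2 \<mu>" using adj g by (auto dest: L2_adjointD)
  have [measurable]: "S g \<in> borel_measurable \<mu>" "g \<in> borel_measurable \<mu>" 
    using Sg g by (auto simp: L2_def)
  have key: "0 \<le> (\<integral>x. f x * Re (S g x) \<partial>\<mu>) \<and> (\<integral>x. f x * Im (S g x) \<partial>\<mu>) = 0"
    if f: "(\<lambda>x. of_real (f x)) \<in> L2 \<mu>" and f0: "\<And>x. 0 \<le> f x" for f :: "'a \<Rightarrow> real"
  proof -
    let ?f = "\<lambda>x. complex_of_real (f x)"
    note int = L2_mult_integrable(2)[OF f Sg]
    have Tf0: "AE x in \<mu>. 0 \<le> T ?f x"
      using pos f f0 by (auto simp: positivity_preserving_def less_eq_complex_def)
    note intT = L2_mult_integrable(2)[OF T[OF f] g]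
    have eq: "l2inner \<mu> (T ?f) g = l2inner \<mu> ?f (S g)" by (rule L2_adjointD(2)[OF adj f g])
    have "0 \<le> Re (l2inner \<mu> (T ?f) g)"
      unfolding l2inner_def Bochner_Integration.integral_Re[OF intT, symmetric]
    proof (rule integral_nonneg_AE)
      show "AE x in \<mu>. 0 \<le> Re (T ?f x * cnj (g x))"
        using Tf0 g0 by eventually_elim (simp add: less_eq_complex_def)
    qed
    moreover have "Im (l2inner \<mu> (T ?f) g) = (\<integral>x. 0 \<partial>\<mu>)"
      unfolding l2inner_def Bochner_Integration.integral_Im[OF intT, symmetric]
    proof (rule integral_cong_AE)
      show "AE x in \<mu>. Im (T ?f x * cnj (g x)) = 0"
        using Tf0 g0 by eventually_elim (simp add: less_eq_complex_def)
    qed (use borel_measurable_integrable[OF integrable_Im[OF intT]] in auto)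
    moreover have "Re (l2inner \<mu> ?f (S g)) = (\<integral>x. f x * Re (S g x) \<partial>\<mu>)"
      unfolding l2inner_def Bochner_Integration.integral_Re[OF int, symmetric] by simp
    moreover have "Im (l2inner \<mu> ?f (S g)) = - (\<integral>x. f x * Im (S g x) \<partial>\<mu>)"
      unfolding l2inner_def Bochner_Integration.integral_Im[OF int, symmetric] by simp
    ultimately show ?thesis using eq by simp
  qed
  have ReL: "(\<lambda>x. of_real (Re (S g x))) \<in> L2 \<mu>" and ImL: "(\<lambda>x. of_real (Im (S g x))) \<in> L2 \<mu>"
    and ImL': "(\<lambda>x. of_real (- Im (S g x))) \<in> L2 \<mu>"
    by (rule L2_bound[OF Sg]; auto simp: abs_Re_le_cmod abs_Im_le_cmod)+
  have "AE x in \<mu>. 0 \<le> Re (S g x)" by (rule AE_nonneg_by_testing[OF ReL]) (simp add: key)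
  moreover have "AE x in \<mu>. 0 \<le> Im (S g x)" 
    by (rule AE_nonneg_by_testing[OF ImL]) (simp add: key)
  moreover have "AE x in \<mu>. 0 \<le> - Im (S g x)" 
    by (rule AE_nonneg_by_testing[OF ImL']) (simp add: key)
  ultimately show "AE x in \<mu>. 0 \<le> S g x" by eventually_elim (simp add: less_eq_complex_def)
qed

text \<open>
  The constant \<open>1\<close> need not lie in \<open>L\<^sup>2\<close>, so the image of \<open>1\<close> under the kernel is reached by the
  images of indicators of an exhaustion. They increase because \<open>T\<close> preserves positivity, and they
  converge by dominated convergence, since almost every row of the kernel is integrable.
\<close>

lemma monotone_approximation_of_kernel_mass:
  fixes A :: "nat \<Rightarrow> 'a set"
  assumes T: "L2_bounded_op \<mu> T" and pos: "positivity_preserving \<mu> T" and ker: "L2_kernel \<mu> T k"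
    and mass: "AE x in \<mu>. integrable \<mu> (\<lambda>y. k x y *\<^sub>R (1::complex))"
    and A: "range A \<subseteq> sets \<mu>" "(\<Union>n. A n) = space \<mu>" "\<And>n. emeasure \<mu> (A n) \<noteq> \<infinity>" "incseq A"
  shows "AE x in \<mu>. (\<forall>n. T (indicator (A n)) x = of_real (Re (T (indicator (A n)) x))
            \<and> 0 \<le> Re (T (indicator (A n)) x))
          \<and> incseq (\<lambda>n. Re (T (indicator (A n)) x))
          \<and> (\<lambda>n. Re (T (indicator (A n)) x)) \<longlonglongrightarrow> kernel_op \<mu> k (\<lambda>_. 1 :: real) x"
proof -
  let ?I = "\<lambda>n. indicator (A n) :: 'a \<Rightarrow> complex"
  have AS: "A n \<in> sets \<mu>" for n using A(1) by auto
  have I: "?I n \<in> L2 \<mu>" for n using AS A(3) by (intro L2_indicator)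
  have D: "indicator (A (Suc n) - A n) \<in> L2 \<mu>" for n
  proof (intro L2_indicator sets.Diff AS)
    have "emeasure \<mu> (A (Suc n) - A n) \<le> emeasure \<mu> (A (Suc n))"
      by (intro emeasure_mono AS) auto
    then show "emeasure \<mu> (A (Suc n) - A n) \<noteq> \<infinity>"
      using A(3)[of "Suc n"] by (metis infinity_ennreal_def top_unique)
  qed
  have pI: "AE x in \<mu>. \<forall>n. 0 \<le> T (?I n) x"
    unfolding AE_all_countable using pos I by (auto simp: positivity_preserving_def less_eq_complex_def indicator_def)
  have inc: "AE x in \<mu>. \<forall>n. Re (T (?I n) x) \<le> Re (T (?I (Suc n)) x)"
    unfolding AE_all_countable
  proof
    fix n
    have "?I (Suc n) = (\<lambda>x. ?I n x + indicator (A (Suc n) - A n) x)"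
      using incseq_SucD[OF A(4), of n] by (auto simp: indicator_def fun_eq_iff)
    then have "AE x in \<mu>. T (?I (Suc n)) x = T (?I n) x + T (indicator (A (Suc n) - A n)) x"
      using T I[of n] D[of n] by (auto simp: L2_bounded_op_def)
    moreover have "AE x in \<mu>. 0 \<le> T (indicator (A (Suc n) - A n)) x"
      using pos D[of n] by (auto simp: positivity_preserving_def less_eq_complex_def indicator_def)
    ultimately show "AE x in \<mu>. Re (T (?I n) x) \<le> Re (T (?I (Suc n)) x)"
      by eventually_elim (simp add: less_eq_complex_def)
  qed
  have kI: "AE x in \<mu>. \<forall>n. T (?I n) x = kernel_op \<mu> k (?I n) x"
    unfolding AE_all_countable using ker I by (auto simp: L2_kernel_def)
  show ?thesis
    using pI inc kI mass
  proof eventually_elim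
    case (elim x)
    have int: "integrable \<mu> (\<lambda>y. k x y)"
      using integrable_Re[OF elim(4)] by simp
    have "T (?I n) x = of_real (\<integral>y. k x y * indicator (A n) y \<partial>\<mu>)" for n
    proof -
      have "T (?I n) x = (\<integral>y. of_real (k x y * indicator (A n) y) \<partial>\<mu>)"
        using elim(3) unfolding kernel_op_def
        by (auto intro!: Bochner_Integration.integral_cong simp: indicator_def scaleR_conv_of_real)
      then show ?thesis by (simp only: integral_complex_of_real)
    qed
    then have Re: "Re (T (?I n) x) = (\<integral>y. k x y * indicator (A n) y \<partial>\<mu>)" for n by simp
    have "(\<lambda>n. \<integral>y. k x y * indicator (A n) y \<partial>\<mu>) \<longlonglongrightarrow> (\<integral>y. k x y \<partial>\<mu>)"
    proof (rule integral_dominated_convergence[where w = "\<lambda>y. \<bar>k x y\<bar>"])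
      show "AE y in \<mu>. (\<lambda>n. k x y * indicator (A n) y) \<longlonglongrightarrow> k x y"
      proof (rule AE_I2)
        fix y assume "y \<in> space \<mu>"
        then obtain m where "y \<in> A m" using A(2) by auto
        then have "\<forall>n\<ge>m. y \<in> A n" using incseqD[OF A(4)] by blast
        then have "\<forall>\<^sub>F n in sequentially. k x y * indicator (A n) y = k x y"
          unfolding eventually_sequentially by (intro exI[of _ m]) auto
        then show "(\<lambda>n. k x y * indicator (A n) y) \<longlonglongrightarrow> k x y" by (rule tendsto_eventually)
      qed
      show "(\<lambda>y. k x y * indicator (A n) y) \<in> borel_measurable \<mu>" for n
        using int AS by measurable
      show "AE y in \<mu>. norm (k x y * indicator (A n) y) \<le> \<bar>k x y\<bar>" for n
        by (auto simp: indicator_def)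
    qed (use int in auto)
    then have "(\<lambda>n. Re (T (?I n) x)) \<longlonglongrightarrow> kernel_op \<mu> k (\<lambda>_. 1 :: real) x"
      unfolding Re kernel_op_def by simp
    then show ?case using elim(1,2) by (auto simp: less_eq_complex_def complex_eq_iff incseq_SucI)
  qed
qed

lemma bounded_monotone_limit_integral:
  fixes f :: "nat \<Rightarrow> 'a \<Rightarrow> real"
  assumes f: "\<And>n. integrable \<mu> (f n)" "\<And>n. (\<integral>x. f n x \<partial>\<mu>) \<le> B"
    and ae: "AE x in \<mu>. (\<forall>n. 0 \<le> f n x) \<and> incseq (\<lambda>n. f n x) \<and> (\<lambda>n. f n x) \<longlonglongrightarrow> g x"
    and g: "g \<in> borel_measurable \<mu>"
  shows "integrable \<mu> g" and "(\<lambda>n. \<integral>x. f n x \<partial>\<mu>) \<longlonglongrightarrow> (\<integral>x. g x \<partial>\<mu>)"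
proof -
  have "incseq (\<lambda>n. \<integral>x. f n x \<partial>\<mu>)"
    by (intro incseq_SucI integral_mono_AE f eventually_mono[OF ae]) (auto simp: incseq_Suc_iff)
  then obtain L where L: "(\<lambda>n. \<integral>x. f n x \<partial>\<mu>) \<longlonglongrightarrow> L"
    using incseq_convergent f(2) by metis
  have a: "AE x in \<mu>. incseq (\<lambda>n. f n x)" "\<And>n. AE x in \<mu>. 0 \<le> f n x" "AE x in \<mu>. (\<lambda>n. f n x) \<longlonglongrightarrow> g x"
    by (rule eventually_mono[OF ae], simp)+
  note m = integral_monotone_convergence_nonneg[OF f(1) a L g]
  show "integrable \<mu> g" by (rule m(1))
  show "(\<lambda>n. \<integral>x. f n x \<partial>\<mu>) \<longlonglongrightarrow> (\<integral>x. g x \<partial>\<mu>)" unfolding m(2) by (rule L)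
qed

lemma bounded_exhaustion_integral:
  fixes g :: "'a \<Rightarrow> real"
  assumes A: "(\<Union>n. A n) = space \<mu>" "incseq A"
    and f: "\<And>n. integrable \<mu> (\<lambda>x. g x * indicator (A n) x)" "\<And>n. (\<integral>x. g x * indicator (A n) x \<partial>\<mu>) \<le> B"
    and g: "AE x in \<mu>. 0 \<le> g x" "g \<in> borel_measurable \<mu>"
  shows "integrable \<mu> g" and "(\<lambda>n. \<integral>x. g x * indicator (A n) x \<partial>\<mu>) \<longlonglongrightarrow> (\<integral>x. g x \<partial>\<mu>)"
proof -
  have "AE x in \<mu>. (\<forall>n. 0 \<le> g x * indicator (A n) x) \<and> incseq (\<lambda>n. g x * indicator (A n) x)
      \<and> (\<lambda>n. g x * indicator (A n) x) \<longlonglongrightarrow> g x"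
    using g(1) AE_space
  proof eventually_elim
    case (elim x)
    obtain m where "x \<in> A m" using A(1) elim by auto
    then have "\<forall>n\<ge>m. x \<in> A n" using incseqD[OF A(2)] by blast
    then have "\<forall>\<^sub>F n in sequentially. g x * indicator (A n) x = g x"
      unfolding eventually_sequentially by (intro exI[of _ m]) auto
    then have "(\<lambda>n. g x * indicator (A n) x) \<longlonglongrightarrow> g x" by (rule tendsto_eventually)
    moreover have "incseq (\<lambda>n. g x * indicator (A n) x)"
      using elim incseq_SucD[OF A(2)] by (intro incseq_SucI) (auto simp: indicator_def)
    ultimately show ?case using elim by simp
  qed
  note lim = bounded_monotone_limit_integral[OF f this g(2)]
  show "integrable \<mu> g" by (rule lim(1))
  show "(\<lambda>n. \<integral>x. g x * indicator (A n) x \<partial>\<mu>) \<longlonglongrightarrow> (\<integral>x. g x \<partial>\<mu>)" by (rule lim(2))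
qed

section \<open>From kernel asymptotics to bilinear forms\<close>

text \<open>
  Both integrations are carried out one after the other, with the nonnegative weights \<open>h\<close> and then
  \<open>k\<close>; a bound on the kernel that holds almost everywhere on the product therefore passes to the
  bilinear form without any exchange of integrals.
\<close>

lemma bilinear_form_rank_one_estimate:
  fixes u :: "'a \<Rightarrow> 'a \<Rightarrow> real"
  assumes sf: "sigma_finite_measure \<mu>"
    and bound: "AE (x, y) in \<mu> \<Otimes>\<^sub>M \<mu>. \<bar>e * u x y - l * \<phi> x * \<psi> y\<bar> \<le> d"
    and k: "integrable \<mu> k" "AE x in \<mu>. 0 \<le> k x" and h: "integrable \<mu> h" "AE x in \<mu>. 0 \<le> h x"
    and V: "AE x in \<mu>. integrable \<mu> (\<lambda>y. u x y * h y) \<and> v x = (\<integral>y. u x y * h y \<partial>\<mu>)"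
    and int: "integrable \<mu> (\<lambda>x. \<phi> x * k x)" "integrable \<mu> (\<lambda>y. \<psi> y * h y)" "integrable \<mu> (\<lambda>x. v x * k x)"
  shows "\<bar>e * (\<integral>x. v x * k x \<partial>\<mu>) - l * (\<integral>x. \<phi> x * k x \<partial>\<mu>) * (\<integral>y. \<psi> y * h y \<partial>\<mu>)\<bar>
      \<le> d * (\<integral>x. k x \<partial>\<mu>) * (\<integral>y. h y \<partial>\<mu>)"
proof -
  interpret sigma_finite_measure \<mu> by (rule sf)
  interpret pair_sigma_finite \<mu> \<mu> ..
  let ?q = "\<integral>y. \<psi> y * h y \<partial>\<mu>" and ?H = "\<integral>y. h y \<partial>\<mu>"
  have "AE x in \<mu>. AE y in \<mu>. \<bar>e * u x y - l * \<phi> x * \<psi> y\<bar> \<le> d"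
    using AE_pair[OF bound] by simp
  then have "AE x in \<mu>. \<bar>e * (v x * k x) - l * ?q * (\<phi> x * k x)\<bar> \<le> d * ?H * k x"
    using V k(2)
  proof eventually_elim
    case (elim x)
    have i1: "integrable \<mu> (\<lambda>y. e * (u x y * h y) - l * \<phi> x * (\<psi> y * h y))"
      using elim int by simp
    have "e * v x - l * ?q * \<phi> x = (\<integral>y. e * (u x y * h y) - l * \<phi> x * (\<psi> y * h y) \<partial>\<mu>)"
      using elim int by (simp add: mult_ac)
    also have "\<bar>\<dots>\<bar> \<le> (\<integral>y. \<bar>e * (u x y * h y) - l * \<phi> x * (\<psi> y * h y)\<bar> \<partial>\<mu>)"
      by (rule integral_abs_bound)
    also have "\<dots> \<le> (\<integral>y. d * h y \<partial>\<mu>)"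
    proof (rule integral_mono_AE)
      show "AE y in \<mu>. \<bar>e * (u x y * h y) - l * \<phi> x * (\<psi> y * h y)\<bar> \<le> d * h y"
        using elim(1) h(2)
      proof eventually_elim
        case (elim y)
        have "e * (u x y * h y) - l * \<phi> x * (\<psi> y * h y) = (e * u x y - l * \<phi> x * \<psi> y) * h y"
          by (simp add: algebra_simps)
        then show ?case using elim by (simp add: abs_mult mult_right_mono)
      qed
    qed (use i1 h in auto)
    finally have "\<bar>e * v x - l * ?q * \<phi> x\<bar> * k x \<le> d * ?H * k x"
      using elim(3) by (intro mult_right_mono) auto
    moreover have "e * (v x * k x) - l * ?q * (\<phi> x * k x) = (e * v x - l * ?q * \<phi> x) * k x"
      by (simp add: algebra_simps)
    ultimately show ?case using elim(3) by (simp add: abs_mult)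
  qed
  note ae = this
  have "e * (\<integral>x. v x * k x \<partial>\<mu>) - l * (\<integral>x. \<phi> x * k x \<partial>\<mu>) * ?q
      = (\<integral>x. e * (v x * k x) - l * ?q * (\<phi> x * k x) \<partial>\<mu>)"
    using int by simp
  also have "\<bar>\<dots>\<bar> \<le> (\<integral>x. \<bar>e * (v x * k x) - l * ?q * (\<phi> x * k x)\<bar> \<partial>\<mu>)"
    by (rule integral_abs_bound)
  also have "\<dots> \<le> (\<integral>x. d * ?H * k x \<partial>\<mu>)"
    using int k ae by (intro integral_mono_AE) auto
  finally show ?thesis by (simp add: mult_ac)
qed


text \<open>
  This is how ground states are seen to be integrable: on each set \<open>A n\<close> the integral of \<open>f\<close> is, up to
  the factor \<open>c\<close>, a pairing of the bounded function \<open>f\<close> with a function of \<open>L\<^sup>1\<close>-norm at most \<open>Z\<close>.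
\<close>

lemma integrable_of_bounded_pairing:
  fixes f :: "'a \<Rightarrow> real"
  assumes f: "AE x in \<mu>. 0 \<le> f x" "AE x in \<mu>. f x \<le> K" "0 \<le> K" "f \<in> borel_measurable \<mu>"
    and A: "(\<Union>n. A n) = space \<mu>" "incseq A" "\<And>n. integrable \<mu> (\<lambda>x. f x * indicator (A n) x)"
    and r: "\<And>n. integrable \<mu> (r n)" "\<And>n. AE x in \<mu>. 0 \<le> r n x" "\<And>n. (\<integral>x. r n x \<partial>\<mu>) \<le> Z"
    and fr: "\<And>n. integrable \<mu> (\<lambda>x. f x * r n x)"
      "\<And>n. (\<integral>x. f x * r n x \<partial>\<mu>) = c * (\<integral>x. f x * indicator (A n) x \<partial>\<mu>)" "0 < c"
  shows "integrable \<mu> f" and "(\<lambda>n. \<integral>x. f x * indicator (A n) x \<partial>\<mu>) \<longlonglongrightarrow> (\<integral>x. f x \<partial>\<mu>)"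
proof -
  have le: "(\<integral>x. f x * indicator (A n) x \<partial>\<mu>) \<le> K * Z / c" for n
  proof -
    have "c * (\<integral>x. f x * indicator (A n) x \<partial>\<mu>) = (\<integral>x. f x * r n x \<partial>\<mu>)" by (simp add: fr(2))
    also have "\<dots> \<le> (\<integral>x. K * r n x \<partial>\<mu>)"
    proof (rule integral_mono_AE)
      show "AE x in \<mu>. f x * r n x \<le> K * r n x"
        using f(2) r(2)[of n] by eventually_elim (rule mult_right_mono)
    qed (use r(1) fr(1) in auto)
    also have "\<dots> \<le> K * Z" using f(3) r(3)[of n] by (simp add: mult_left_mono)
    finally show ?thesis using fr(3) by (simp add: pos_le_divide_eq mult.commute)
  qed
  note lim = bounded_exhaustion_integral[OF A(1,2,3) le f(1,4)]
  show "integrable \<mu> f" by (rule lim(1))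
  show "(\<lambda>n. \<integral>x. f x * indicator (A n) x \<partial>\<mu>) \<longlonglongrightarrow> (\<integral>x. f x \<partial>\<mu>)" by (rule lim(2))
qed

section \<open>Exponential convergence of the heat content\<close>

theorem corollary6p2:
  fixes \<mu> :: "'a::polish_space measure"
    and U Us :: "real \<Rightarrow> ('a \<Rightarrow> complex) \<Rightarrow> ('a \<Rightarrow> complex)"
    and u :: "real \<Rightarrow> 'a \<Rightarrow> 'a \<Rightarrow> real"
    and \<phi>0 \<psi>0 :: "'a \<Rightarrow> real"
    and t0 t1 lam0 \<Lambda> \<gamma> :: real
  assumes loc_compact: "locally_compact_space (euclidean :: 'a topology)"
    and borel: "sets \<mu> = sets borel"
    and loc_finite: "\<forall>x. \<exists>V. open V \<and> x \<in> V \<and> emeasure \<mu> V < \<infinity>"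
    and full_support: "\<forall>V. open V \<and> V \<noteq> {} \<longrightarrow> emeasure \<mu> V > 0"
    and semigroup: "C0_semigroup \<mu> U"
    and pos_preserving: "\<forall>t\<ge>0. positivity_preserving \<mu> (U t)"
    and adjoint: "\<forall>t\<ge>0. L2_adjoint \<mu> (U t) (Us t)"
    and kernel_meas: "\<forall>t>0. (\<lambda>(x, y). u t x y) \<in> borel_measurable (\<mu> \<Otimes>\<^sub>M \<mu>)"
    and kernel: "\<forall>t>0. L2_kernel \<mu> (U t) (u t)"
    and kernel_adj: "\<forall>t>0. L2_kernel \<mu> (Us t) (\<lambda>y x. u t x y)"
    and t0: "t0 > 0"
    and compact: "\<forall>t>0. L2_compact_op \<mu> (U t)"
    and improving: "positivity_improving \<mu> (U t0)"
    and feller: "\<forall>t>0. strong_feller \<mu> (u t)"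
    and feller_adj: "\<forall>t>0. strong_feller \<mu> (\<lambda>y x. u t x y)"
    and smoothing: "L2_Linf_bounded \<mu> (U t0)"
    and smoothing_adj: "L2_Linf_bounded \<mu> (Us t0)"
    and lam0: "lam0 = Inf (Re ` op_spectrum \<mu> (neg_op (generator \<mu> U)))"
    and \<phi>0_eigen: "eigenfunction \<mu> (neg_op (generator \<mu> U)) (of_real lam0) (\<lambda>x. of_real (\<phi>0 x))"
    and \<phi>0_norm: "l2norm \<mu> (\<lambda>x. of_real (\<phi>0 x)) = 1"
    and \<phi>0_pos: "AE x in \<mu>. \<phi>0 x > 0"
    and \<psi>0_eigen: "eigenfunction \<mu> (neg_op (generator \<mu> Us)) (of_real lam0) (\<lambda>x. of_real (\<psi>0 x))"
    and \<psi>0_norm: "l2norm \<mu> (\<lambda>x. of_real (\<psi>0 x)) = 1"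
    and \<psi>0_pos: "AE x in \<mu>. \<psi>0 x > 0"
    and \<Lambda>: "\<Lambda> = (\<integral>x. \<phi>0 x * \<psi>0 x \<partial>\<mu>)"
    and \<gamma>_pos: "\<gamma> > 0"
    and \<gamma>: "\<exists>C0>0. \<forall>t>2 * t0. AE (x, y) in \<mu> \<Otimes>\<^sub>M \<mu>.
              \<bar>exp (lam0 * t) * u t x y - inverse \<Lambda> * \<phi>0 x * \<psi>0 y\<bar> \<le> C0 * exp (- \<gamma> * t)"
    and t1: "t1 \<ge> t0"
    and finite_heat: "heat_content \<mu> u t1 < \<infinity>"
  shows "\<exists>C>0. \<forall>t>6 * t1.
           \<bar>ereal (exp (lam0 * t)) * enn2ereal (heat_content \<mu> u t)
              - enn2ereal (l1norm \<mu> \<phi>0) * enn2ereal (l1norm \<mu> \<psi>0) / ereal \<Lambda>\<bar>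
             \<le> ereal (C * exp (- \<gamma> * t))"
proof -
  note sf = sigma_finite_of_locally_finite[OF borel loc_finite]
  interpret sigma_finite_measure \<mu> by (rule sf)
  obtain A :: "nat \<Rightarrow> 'a set" where A: "range A \<subseteq> sets \<mu>" "(\<Union>n. A n) = space \<mu>"
      "\<And>n. emeasure \<mu> (A n) \<noteq> \<infinity>" "incseq A"
    using sigma_finite_incseq by metis
  have t1pos: "0 < t1" using t0 t1 by simp
  \<comment> \<open>The functions \<open>h t n\<close> increase to \<open>w t\<close>, the image of \<open>1\<close> under \<open>U t\<close>; the \<open>k n\<close> play the same role
    for the adjoint at time \<open>t1\<close>.\<close>
  define I where "I n = (indicator (A n) :: 'a \<Rightarrow> complex)" for n
  define h where "h t n x = Re (U t (I n) x)" for t n x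
  define k where "k n x = Re (Us t1 (I n) x)" for n x
  define w where "w t = kernel_op \<mu> (u t) (\<lambda>_. 1 :: real)" for t
  have AS [measurable]: "A n \<in> sets \<mu>" for n using A(1) by auto
  have I: "I n \<in> L2 \<mu>" for n unfolding I_def by (intro L2_indicator AS A)
  have I_real: "AE x in \<mu>. I n x = of_real (indicator (A n) x)" for n
    by (simp add: I_def indicator_def)
  have UL: "U t f \<in> L2 \<mu>" if "0 \<le> t" "f \<in> L2 \<mu>" for t f
    using C0_semigroup_L2[OF semigroup that] .
  have adj1: "L2_adjoint \<mu> (U t1) (Us t1)" using adjoint t1pos by simp
  have UsL: "Us t f \<in> L2 \<mu>" if "0 \<le> t" "f \<in> L2 \<mu>" for t f
    using L2_adjointD(1)[OF adjoint[rule_format, OF that(1)] that(2)] .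
  have meas_h [measurable]: "h t n \<in> borel_measurable \<mu>" if "0 \<le> t" for t n
  proof -
    have [measurable]: "U t (I n) \<in> borel_measurable \<mu>" using UL[OF that I] by (simp add: L2_def)
    show ?thesis unfolding h_def by measurable
  qed
  have meas_k [measurable]: "k n \<in> borel_measurable \<mu>" for n
  proof -
    have [measurable]: "Us t1 (I n) \<in> borel_measurable \<mu>" using UsL[OF _ I] t1pos by (simp add: L2_def)
    show ?thesis unfolding k_def by measurable
  qed
  have meas_w [measurable]: "w t \<in> borel_measurable \<mu>" if "0 < t" for t
    unfolding w_def kernel_op_def using kernel_meas that
    by (intro borel_measurable_lebesgue_integral) simp

  have mono: "AE x in \<mu>. (\<forall>n. U t (I n) x = of_real (h t n x) \<and> 0 \<le> h t n x)
      \<and> incseq (\<lambda>n. h t n x) \<and> (\<lambda>n. h t n x) \<longlonglongrightarrow> w t x" if t: "0 < t" for t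
    unfolding I_def h_def w_def
  proof (rule monotone_approximation_of_kernel_mass[OF _ _ _ _ A])
    show "L2_bounded_op \<mu> (U t)" using semigroup t by (simp add: C0_semigroup_def)
    show "positivity_preserving \<mu> (U t)" using pos_preserving t by simp
    show "L2_kernel \<mu> (U t) (u t)" using kernel t by simp
    have "(\<lambda>_. 1) \<in> Linf \<mu>" unfolding Linf_def by (auto intro: exI[of _ 1])
    then show "AE x in \<mu>. integrable \<mu> (\<lambda>y. u t x y *\<^sub>R (1::complex))"
      using feller[rule_format, OF t] unfolding strong_feller_def by (auto dest: bspec)
  qed
  have h_real: "AE x in \<mu>. U t (I n) x = of_real (h t n x)" if "0 < t" for t n
    using mono[OF that] by eventually_elim simp
  have h_nonneg: "AE x in \<mu>. 0 \<le> h t n x" if "0 < t" for t n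
    using mono[OF that] by eventually_elim simp
  have h_le_w: "AE x in \<mu>. h t n x \<le> w t x" if "0 < t" for t n
    using mono[OF that]
  proof eventually_elim
    case (elim x)
    then show ?case using incseq_le[of "\<lambda>n. h t n x" "w t x" n] by simp
  qed
  have w_nonneg: "AE x in \<mu>. 0 \<le> w t x" if "0 < t" for t
    using h_nonneg[OF that, of 0] h_le_w[OF that, of 0] by eventually_elim simp
  have heat: "heat_content \<mu> u t = ennreal (\<integral>x. w t x \<partial>\<mu>)" if "0 < t" "integrable \<mu> (w t)" for t
    using nn_integral_eq_integral[OF that(2) w_nonneg[OF that(1)]] by (simp add: heat_content_def w_def)

  have k_pos: "AE x in \<mu>. 0 \<le> Us t1 (I n) x" for n
  proof -
    have "positivity_preserving \<mu> (Us t1)"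
      using t1pos by (intro adjoint_positivity_preserving[OF adj1] pos_preserving[rule_format] UL) auto
    then show ?thesis using I[of n]
      by (auto simp: positivity_preserving_def I_def indicator_def less_eq_complex_def)
  qed
  have k_real: "AE x in \<mu>. Us t1 (I n) x = of_real (k n x)" for n
    using k_pos[of n] by eventually_elim (simp add: k_def less_eq_complex_def complex_eq_iff)
  have k_nonneg: "AE x in \<mu>. 0 \<le> k n x" for n
    using k_pos[of n] by eventually_elim (simp add: k_def less_eq_complex_def)

  define Z where "Z = (\<integral>x. w t1 x \<partial>\<mu>)"
  have w_int: "integrable \<mu> (w t1)"
  proof (rule integrableI_bounded)
    have "(\<integral>\<^sup>+ x. ennreal (norm (w t1 x)) \<partial>\<mu>) = heat_content \<mu> u t1"
      unfolding heat_content_def w_def[symmetric] using w_nonneg[OF t1pos]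
      by (intro nn_integral_cong_AE) (auto elim!: eventually_mono)
    then show "(\<integral>\<^sup>+ x. ennreal (norm (w t1 x)) \<partial>\<mu>) < \<infinity>" using finite_heat by simp
  qed (use t1pos in measurable)
  have Z0: "0 \<le> Z" unfolding Z_def by (rule integral_nonneg_AE[OF w_nonneg[OF t1pos]])
  have h_int: "integrable \<mu> (h t1 n)" for n
  proof (rule Bochner_Integration.integrable_bound[OF w_int])
    show "AE x in \<mu>. norm (h t1 n x) \<le> norm (w t1 x)"
      using h_nonneg[OF t1pos, of n] h_le_w[OF t1pos, of n] by eventually_elim simp
  qed (use t1pos in \<open>auto intro: meas_h\<close>)
  have h_Z: "(\<integral>x. h t1 n x \<partial>\<mu>) \<le> Z" for n
    unfolding Z_def by (rule integral_mono_AE[OF h_int w_int h_le_w[OF t1pos]])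

  \<comment> \<open>By duality the masses of \<open>k n\<close> are controlled by those of \<open>h t1 m\<close>, so that the adjoint side obeys
    the same bound \<open>Z\<close>.\<close>
  have k_trunc: "integrable \<mu> (\<lambda>x. k n x * indicator (A m) x)"
      "(\<integral>x. k n x * indicator (A m) x \<partial>\<mu>) \<le> Z" for n m
  proof -
    have hI: "l2inner \<mu> (U t1 (I m)) (I n) = of_real (\<integral>x. h t1 m x * indicator (A n) x \<partial>\<mu>)"
         "integrable \<mu> (\<lambda>x. h t1 m x * indicator (A n) x)"
      using l2inner_real[OF UL[OF _ I] I h_real[OF t1pos] I_real] t1pos by auto
    have kI: "l2inner \<mu> (Us t1 (I n)) (I m) = of_real (\<integral>x. k n x * indicator (A m) x \<partial>\<mu>)"
         "integrable \<mu> (\<lambda>x. k n x * indicator (A m) x)"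
      using l2inner_real[OF UsL[OF _ I] I k_real I_real] t1pos by auto
    show "integrable \<mu> (\<lambda>x. k n x * indicator (A m) x)" by (rule kI(2))
    have "l2inner \<mu> (Us t1 (I n)) (I m) = cnj (l2inner \<mu> (U t1 (I m)) (I n))"
      unfolding L2_adjointD(2)[OF adj1 I I] by (rule l2inner_cnj)
    then have "(\<integral>x. k n x * indicator (A m) x \<partial>\<mu>) = (\<integral>x. h t1 m x * indicator (A n) x \<partial>\<mu>)"
      unfolding hI kI by (metis complex_cnj_complex_of_real of_real_eq_iff)
    also have "\<dots> \<le> (\<integral>x. h t1 m x \<partial>\<mu>)"
    proof (rule integral_mono_AE[OF hI(2) h_int])
      show "AE x in \<mu>. h t1 m x * indicator (A n) x \<le> h t1 m x"
        using h_nonneg[OF t1pos, of m] by eventually_elim (simp add: indicator_def)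
    qed
    also have "\<dots> \<le> Z" by (rule h_Z)
    finally show "(\<integral>x. k n x * indicator (A m) x \<partial>\<mu>) \<le> Z" .
  qed
  note k_lim = bounded_exhaustion_integral[OF A(2,4) k_trunc k_nonneg meas_k]
  have k_int: "integrable \<mu> (k n)" for n by (rule k_lim(1))
  have k_Z: "(\<integral>x. k n x \<partial>\<mu>) \<le> Z" for n
    using LIMSEQ_le_const2[OF k_lim(2)] k_trunc(2) by blast

  have phiL: "(\<lambda>x. of_real (\<phi>0 x)) \<in> L2 \<mu>" and phi_ne: "\<not> (AE x in \<mu>. of_real (\<phi>0 x) = (0::complex))"
    using \<phi>0_eigen by (auto simp: eigenfunction_def neg_op_def generator_def)
  have psiL: "(\<lambda>x. of_real (\<psi>0 x)) \<in> L2 \<mu>"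
    using \<psi>0_eigen by (auto simp: eigenfunction_def neg_op_def generator_def)
  have [measurable]: "\<phi>0 \<in> borel_measurable \<mu>" "\<psi>0 \<in> borel_measurable \<mu>"
    using phiL psiL by (auto intro: measurable_of_complex_L2)
  have phi0: "AE x in \<mu>. 0 \<le> \<phi>0 x" using \<phi>0_pos by eventually_elim simp
  have psi0: "AE x in \<mu>. 0 \<le> \<psi>0 x" using \<psi>0_pos by eventually_elim simp
  note eigU = eigenfunction_semigroup[OF semigroup adjoint \<phi>0_eigen]
  note eigUs = eigenfunction_adjoint_semigroup[OF semigroup adjoint \<psi>0_eigen]

  \<comment> \<open>Positivity of \<open>\<Lambda>\<close> makes the division in the conclusion a division of real numbers.\<close>
  have Lpos: "0 < \<Lambda>"
  proof -
    have int: "integrable \<mu> (\<lambda>x. \<phi>0 x * \<psi>0 x)"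
      by (rule l2inner_real(2)[OF phiL psiL]) auto
    have nn: "AE x in \<mu>. 0 \<le> \<phi>0 x * \<psi>0 x" using phi0 psi0 by eventually_elim simp
    have "\<Lambda> \<noteq> 0"
    proof
      assume "\<Lambda> = 0"
      then have "AE x in \<mu>. \<phi>0 x * \<psi>0 x = 0"
        using integral_nonneg_eq_0_iff_AE[OF int nn] \<Lambda> by simp
      then have "AE x in \<mu>. of_real (\<phi>0 x) = (0::complex)"
        using \<psi>0_pos by eventually_elim simp
      then show False using phi_ne by simp
    qed
    moreover have "0 \<le> \<Lambda>" unfolding \<Lambda> by (rule integral_nonneg_AE[OF nn])
    ultimately show ?thesis by simp
  qed

  define E where "E = exp (- lam0 * t1)"
  have E: "0 < E" by (simp add: E_def)
  obtain Kp where Kp: "0 \<le> Kp" "AE x in \<mu>. norm (complex_of_real (\<phi>0 x)) \<le> Kp"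
    using smoothing_eigenfunction_bounded[OF smoothing phiL UL[OF _ phiL] eigU] t0 by auto
  obtain Kq where Kq: "0 \<le> Kq" "AE x in \<mu>. norm (complex_of_real (\<psi>0 x)) \<le> Kq"
    using smoothing_eigenfunction_bounded[OF smoothing_adj psiL UsL[OF _ psiL] eigUs] t0 by auto

  define p where "p n = (\<integral>x. \<phi>0 x * indicator (A n) x \<partial>\<mu>)" for n
  define q where "q n = (\<integral>x. \<psi>0 x * indicator (A n) x \<partial>\<mu>)" for n
  have phi_I: "l2inner \<mu> (\<lambda>x. of_real (\<phi>0 x)) (I n) = of_real (p n)"
       "integrable \<mu> (\<lambda>x. \<phi>0 x * indicator (A n) x)" for n
    unfolding p_def using l2inner_real[OF phiL I _ I_real, of \<phi>0] by auto
  have psi_I: "l2inner \<mu> (\<lambda>x. of_real (\<psi>0 x)) (I n) = of_real (q n)"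
       "integrable \<mu> (\<lambda>x. \<psi>0 x * indicator (A n) x)" for n
    unfolding q_def using l2inner_real[OF psiL I _ I_real, of \<psi>0] by auto
  have phi_k: "integrable \<mu> (\<lambda>x. \<phi>0 x * k n x)" "(\<integral>x. \<phi>0 x * k n x \<partial>\<mu>) = E * p n" for n
  proof -
    have pk: "l2inner \<mu> (\<lambda>x. of_real (\<phi>0 x)) (Us t1 (I n)) = of_real (\<integral>x. \<phi>0 x * k n x \<partial>\<mu>)"
         "integrable \<mu> (\<lambda>x. \<phi>0 x * k n x)"
      using l2inner_real[OF phiL UsL[OF _ I] _ k_real, of \<phi>0] t1pos by auto
    show "integrable \<mu> (\<lambda>x. \<phi>0 x * k n x)" by (rule pk(2))
    have "of_real (\<integral>x. \<phi>0 x * k n x \<partial>\<mu>) = of_real E * complex_of_real (p n)"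
      using pk(1) L2_adjointD(2)[OF adj1 phiL I] eigU[OF _ I, of t1] t1pos phi_I(1) by (simp add: E_def)
    then show "(\<integral>x. \<phi>0 x * k n x \<partial>\<mu>) = E * p n" by (metis of_real_eq_iff of_real_mult)
  qed
  have psi_h: "integrable \<mu> (\<lambda>x. \<psi>0 x * h t1 n x)" "(\<integral>x. \<psi>0 x * h t1 n x \<partial>\<mu>) = E * q n" for n
  proof -
    have qh: "l2inner \<mu> (\<lambda>x. of_real (\<psi>0 x)) (U t1 (I n)) = of_real (\<integral>x. \<psi>0 x * h t1 n x \<partial>\<mu>)"
         "integrable \<mu> (\<lambda>x. \<psi>0 x * h t1 n x)"
      using l2inner_real[OF psiL UL[OF _ I] _ h_real[OF t1pos], of \<psi>0] t1pos by auto
    show "integrable \<mu> (\<lambda>x. \<psi>0 x * h t1 n x)" by (rule qh(2))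
    have "l2inner \<mu> (\<lambda>x. of_real (\<psi>0 x)) (U t1 (I n)) = cnj (l2inner \<mu> (I n) (Us t1 (\<lambda>x. of_real (\<psi>0 x))))"
      unfolding L2_adjointD(2)[OF adj1 I psiL, symmetric] by (rule l2inner_cnj)
    also have "\<dots> = l2inner \<mu> (Us t1 (\<lambda>x. of_real (\<psi>0 x))) (I n)" by (rule l2inner_cnj[symmetric])
    finally have "of_real (\<integral>x. \<psi>0 x * h t1 n x \<partial>\<mu>) = of_real E * complex_of_real (q n)"
      using qh(1) eigUs[OF _ I, of t1] t1pos psi_I(1) by (simp add: E_def)
    then show "(\<integral>x. \<psi>0 x * h t1 n x \<partial>\<mu>) = E * q n" by (metis of_real_eq_iff of_real_mult)
  qed
  define P where "P = (\<integral>x. \<phi>0 x \<partial>\<mu>)"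
  define Q where "Q = (\<integral>x. \<psi>0 x \<partial>\<mu>)"
  have phi_int: "integrable \<mu> \<phi>0" and p_lim: "p \<longlonglongrightarrow> P"
    unfolding p_def[abs_def] P_def
  proof -
    have "AE x in \<mu>. \<phi>0 x \<le> Kp" using Kp(2) by eventually_elim simp
    from integrable_of_bounded_pairing[OF phi0 this Kp(1) _ A(2,4) phi_I(2) k_int k_nonneg k_Z
        phi_k(1) phi_k(2)[unfolded p_def] E]
    show "integrable \<mu> \<phi>0" "(\<lambda>n. \<integral>x. \<phi>0 x * indicator (A n) x \<partial>\<mu>) \<longlonglongrightarrow> (\<integral>x. \<phi>0 x \<partial>\<mu>)" by simp_all
  qed
  have psi_int: "integrable \<mu> \<psi>0" and q_lim: "q \<longlonglongrightarrow> Q"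
    unfolding q_def[abs_def] Q_def
  proof -
    have "AE x in \<mu>. \<psi>0 x \<le> Kq" using Kq(2) by eventually_elim simp
    from integrable_of_bounded_pairing[OF psi0 this Kq(1) _ A(2,4) psi_I(2) h_int h_nonneg[OF t1pos] h_Z
        psi_h(1) psi_h(2)[unfolded q_def] E]
    show "integrable \<mu> \<psi>0" "(\<lambda>n. \<integral>x. \<psi>0 x * indicator (A n) x \<partial>\<mu>) \<longlonglongrightarrow> (\<integral>x. \<psi>0 x \<partial>\<mu>)" by simp_all
  qed
  have p_bd: "0 \<le> p n" "p n \<le> P" for n
  proof -
    show "0 \<le> p n" unfolding p_def
      by (rule integral_nonneg_AE) (rule eventually_mono[OF phi0], simp)
    show "p n \<le> P" unfolding p_def P_def
      by (rule integral_mono_AE[OF phi_I(2) phi_int]) (rule eventually_mono[OF phi0], simp add: indicator_def)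
  qed
  have q_bd: "0 \<le> q n" "q n \<le> Q" for n
  proof -
    show "0 \<le> q n" unfolding q_def
      by (rule integral_nonneg_AE) (rule eventually_mono[OF psi0], simp)
    show "q n \<le> Q" unfolding q_def Q_def
      by (rule integral_mono_AE[OF psi_I(2) psi_int]) (rule eventually_mono[OF psi0], simp add: indicator_def)
  qed

  obtain C0 where C0: "C0 > 0" "\<And>t. t > 2 * t0 \<Longrightarrow> AE (x, y) in \<mu> \<Otimes>\<^sub>M \<mu>.
              \<bar>exp (lam0 * t) * u t x y - inverse \<Lambda> * \<phi>0 x * \<psi>0 y\<bar> \<le> C0 * exp (- \<gamma> * t)"
    using \<gamma> by blast
  \<comment> \<open>The exponential factor compensates for evaluating the kernel at time \<open>t - 2 t1\<close> and for the two
    factors \<open>E\<close>; the summand \<open>1\<close> keeps \<open>C\<close> positive when \<open>Z = 0\<close>.\<close>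
  define C where "C = C0 * exp (2 * (lam0 + \<gamma>) * t1) * Z\<^sup>2 + 1"
  have Cpos: "C > 0" unfolding C_def using C0(1) by (intro add_nonneg_pos mult_nonneg_nonneg) auto

  have main: "integrable \<mu> (w t) \<and>
      \<bar>exp (lam0 * t) * (\<integral>x. w t x \<partial>\<mu>) - P * Q / \<Lambda>\<bar> \<le> C * exp (- \<gamma> * t)" if t: "t > 6 * t1" for t
  proof -
    define s where "s = t - 2 * t1"
    have s: "s > 2 * t0" "0 < s" "t = t1 + (s + t1)" "0 < t" using t t1 t1pos by (auto simp: s_def)
    define a where "a n = (\<integral>x. h t n x * indicator (A n) x \<partial>\<mu>)" for n
    have aI: "l2inner \<mu> (U t (I n)) (I n) = of_real (a n)"
        "integrable \<mu> (\<lambda>x. h t n x * indicator (A n) x)" for n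
      unfolding a_def using l2inner_real[OF UL[OF _ I] I h_real[OF s(4)] I_real] s(4) by auto
    \<comment> \<open>The truncated heat content \<open>a n\<close> already satisfies the claimed estimate, with a constant that does
      not depend on \<open>n\<close>.\<close>
    have est: "\<bar>exp (lam0 * t) * a n - inverse \<Lambda> * p n * q n\<bar> \<le> C * exp (- \<gamma> * t)" for n
    proof -
      let ?W = "U s (U t1 (I n))"
      define v where "v x = Re (?W x)" for x
      have U1: "U t1 (I n) \<in> L2 \<mu>" and W: "?W \<in> L2 \<mu>" and U2: "U (s + t1) (I n) \<in> L2 \<mu>"
        using UL I s(2) t1pos by auto
      have [measurable]: "v \<in> borel_measurable \<mu>"
      proof -
        have [measurable]: "?W \<in> borel_measurable \<mu>" using W by (simp add: L2_def)
        show ?thesis unfolding v_def by measurable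
      qed
      have "AE x in \<mu>. 0 \<le> U t1 (I n) x"
        using h_real[OF t1pos, of n] h_nonneg[OF t1pos, of n] by eventually_elim (simp add: less_eq_complex_def)
      then have "AE x in \<mu>. 0 \<le> ?W x"
        using pos_preserving s(2) U1 by (auto simp: positivity_preserving_def)
      then have v_real: "AE x in \<mu>. ?W x = of_real (v x)"
        by eventually_elim (simp add: v_def less_eq_complex_def complex_eq_iff)
      have vk: "l2inner \<mu> ?W (Us t1 (I n)) = of_real (\<integral>x. v x * k n x \<partial>\<mu>)"
          "integrable \<mu> (\<lambda>x. v x * k n x)"
        using l2inner_real[OF W UsL[OF _ I] v_real k_real] t1pos by auto
      \<comment> \<open>One factor \<open>U t1\<close> goes to each of the two indicators; the factor \<open>U s\<close> left in the middle has
        \<open>s > 2 t0\<close>, where the kernel asymptotics are available.\<close>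
      have "l2inner \<mu> (U t (I n)) (I n) = l2inner \<mu> (U t1 (U (s + t1) (I n))) (I n)"
        unfolding s(3) using s(2) t1pos by (intro C0_semigroup_weak_add[OF semigroup] I) auto
      also have "\<dots> = l2inner \<mu> (U (s + t1) (I n)) (Us t1 (I n))"
        by (rule L2_adjointD(2)[OF adj1 U2 I])
      also have "\<dots> = l2inner \<mu> ?W (Us t1 (I n))"
        using s(2) t1pos by (intro C0_semigroup_weak_add[OF semigroup] I UsL) auto
      finally have a_eq: "a n = (\<integral>x. v x * k n x \<partial>\<mu>)"
        unfolding aI vk by (metis of_real_eq_iff)
      have V: "AE x in \<mu>. integrable \<mu> (\<lambda>y. u s x y * h t1 n y) \<and> v x = (\<integral>y. u s x y * h t1 n y \<partial>\<mu>)"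
      proof -
        have "AE x in \<mu>. integrable \<mu> (\<lambda>y. u s x y *\<^sub>R U t1 (I n) y) \<and> ?W x = kernel_op \<mu> (u s) (U t1 (I n)) x"
          using kernel s(2) U1 by (auto simp: L2_kernel_def)
        then show ?thesis
        proof eventually_elim
          case (elim x)
          then have int: "integrable \<mu> (\<lambda>y. u s x y *\<^sub>R U t1 (I n) y)" by simp
          have "v x = (\<integral>y. Re (u s x y *\<^sub>R U t1 (I n) y) \<partial>\<mu>)"
            unfolding Bochner_Integration.integral_Re[OF int] using elim by (simp add: v_def kernel_op_def)
          then show ?case using integrable_Re[OF int] by (simp add: h_def)
        qed
      qed
      have "\<bar>exp (lam0 * s) * a n - inverse \<Lambda> * (E * p n) * (E * q n)\<bar>
          \<le> C0 * exp (- \<gamma> * s) * (\<integral>x. k n x \<partial>\<mu>) * (\<integral>y. h t1 n y \<partial>\<mu>)"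
        using bilinear_form_rank_one_estimate[OF sf C0(2)[OF s(1)] k_int k_nonneg h_int h_nonneg[OF t1pos]
            V phi_k(1) psi_h(1) vk(2)]
        unfolding a_eq phi_k(2) psi_h(2) .
      also have "\<dots> \<le> C0 * exp (- \<gamma> * s) * Z * Z"
        using C0(1) k_Z h_Z Z0 integral_nonneg_AE[OF k_nonneg[of n]] integral_nonneg_AE[OF h_nonneg[OF t1pos, of n]]
        by (intro mult_mono mult_nonneg_nonneg) auto
      finally have "exp (2 * lam0 * t1) * \<bar>exp (lam0 * s) * a n - inverse \<Lambda> * (E * p n) * (E * q n)\<bar>
          \<le> exp (2 * lam0 * t1) * (C0 * exp (- \<gamma> * s) * Z * Z)"
        by (rule mult_left_mono) simp
      also have "exp (2 * lam0 * t1) * (C0 * exp (- \<gamma> * s) * Z * Z) = (C - 1) * exp (- \<gamma> * t)"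
      proof -
        have "exp (2 * lam0 * t1) * exp (- \<gamma> * s) = exp (2 * (lam0 + \<gamma>) * t1) * exp (- \<gamma> * t)"
          unfolding s_def by (simp add: algebra_simps flip: exp_add)
        then show ?thesis unfolding C_def by (simp add: power2_eq_square mult_ac)
      qed
      also have "\<dots> \<le> C * exp (- \<gamma> * t)" by simp
      also have "exp (2 * lam0 * t1) * \<bar>exp (lam0 * s) * a n - inverse \<Lambda> * (E * p n) * (E * q n)\<bar>
          = \<bar>exp (lam0 * t) * a n - inverse \<Lambda> * p n * q n\<bar>"
      proof -
        have e1: "exp (2 * lam0 * t1) * exp (lam0 * s) = exp (lam0 * t)"
          unfolding s_def by (simp add: algebra_simps flip: exp_add)
        have e2: "exp (2 * lam0 * t1) * (E * E) = 1"
          unfolding E_def by (simp flip: exp_add)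
        have "exp (2 * lam0 * t1) * \<bar>exp (lam0 * s) * a n - inverse \<Lambda> * (E * p n) * (E * q n)\<bar>
            = \<bar>exp (2 * lam0 * t1) * (exp (lam0 * s) * a n - inverse \<Lambda> * (E * p n) * (E * q n))\<bar>"
          by (simp add: abs_mult)
        also have "exp (2 * lam0 * t1) * (exp (lam0 * s) * a n - inverse \<Lambda> * (E * p n) * (E * q n))
            = (exp (2 * lam0 * t1) * exp (lam0 * s)) * a n - (exp (2 * lam0 * t1) * (E * E)) * (inverse \<Lambda> * p n * q n)"
          by (simp add: algebra_simps)
        finally show ?thesis unfolding e1 e2 by simp
      qed
      finally show ?thesis .
    qed
    \<comment> \<open>A bound that is uniform in \<open>n\<close> yields finiteness of the heat content at time \<open>t\<close>.\<close>
    have a_bd: "a n \<le> (C * exp (- \<gamma> * t) + inverse \<Lambda> * P * Q) / exp (lam0 * t)" for n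
    proof -
      have "inverse \<Lambda> * p n * q n \<le> inverse \<Lambda> * P * Q"
        using Lpos p_bd[of n] q_bd[of n] by (intro mult_mono mult_nonneg_nonneg) auto
      then have "exp (lam0 * t) * a n \<le> C * exp (- \<gamma> * t) + inverse \<Lambda> * P * Q"
        using est[of n] by linarith
      then show ?thesis by (simp add: pos_le_divide_eq mult.commute)
    qed
    have ae: "AE x in \<mu>. (\<forall>n. 0 \<le> h t n x * indicator (A n) x) \<and> incseq (\<lambda>n. h t n x * indicator (A n) x)
        \<and> (\<lambda>n. h t n x * indicator (A n) x) \<longlonglongrightarrow> w t x"
      using mono[OF s(4)] AE_space
    proof eventually_elim
      case (elim x)
      obtain m where "x \<in> A m" using A(2) elim by auto
      then have "\<forall>n\<ge>m. x \<in> A n" using incseqD[OF A(4)] by blast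
      then have "\<forall>\<^sub>F n in sequentially. h t n x = h t n x * indicator (A n) x"
        unfolding eventually_sequentially by (intro exI[of _ m]) auto
      then have "(\<lambda>n. h t n x * indicator (A n) x) \<longlonglongrightarrow> w t x"
        using elim by (auto intro: Lim_transform_eventually)
      moreover have "incseq (\<lambda>n. h t n x * indicator (A n) x)"
      proof (rule incseq_SucI)
        fix n
        show "h t n x * indicator (A n) x \<le> h t (Suc n) x * indicator (A (Suc n)) x"
          using elim incseq_SucD[OF A(4), of n] by (auto simp: indicator_def incseq_Suc_iff)
      qed
      ultimately show ?case using elim by simp
    qed
    note lim = bounded_monotone_limit_integral[OF aI(2) a_bd[unfolded a_def] ae meas_w[OF s(4)]]
    have "(\<lambda>n. \<bar>exp (lam0 * t) * a n - inverse \<Lambda> * p n * q n\<bar>)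
        \<longlonglongrightarrow> \<bar>exp (lam0 * t) * (\<integral>x. w t x \<partial>\<mu>) - inverse \<Lambda> * P * Q\<bar>"
      by (intro tendsto_intros p_lim q_lim lim(2)[folded a_def])
    then have "\<bar>exp (lam0 * t) * (\<integral>x. w t x \<partial>\<mu>) - inverse \<Lambda> * P * Q\<bar> \<le> C * exp (- \<gamma> * t)"
      by (rule LIMSEQ_le_const2) (use est in blast)
    moreover have "inverse \<Lambda> * P * Q = P * Q / \<Lambda>" by (simp add: divide_inverse)
    ultimately show ?thesis using lim(1) by simp
  qed

  have l1: "l1norm \<mu> \<phi>0 = ennreal P" "l1norm \<mu> \<psi>0 = ennreal Q"
  proof -
    have "l1norm \<mu> \<phi>0 = (\<integral>\<^sup>+ x. ennreal (\<phi>0 x) \<partial>\<mu>)" "l1norm \<mu> \<psi>0 = (\<integral>\<^sup>+ x. ennreal (\<psi>0 x) \<partial>\<mu>)"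
      unfolding l1norm_def
      by (rule nn_integral_cong_AE, rule eventually_mono[OF phi0], simp)
        (rule nn_integral_cong_AE, rule eventually_mono[OF psi0], simp)
    then show "l1norm \<mu> \<phi>0 = ennreal P" "l1norm \<mu> \<psi>0 = ennreal Q"
      unfolding P_def Q_def using nn_integral_eq_integral phi_int psi_int phi0 psi0 by metis+
  qed
  have PQ0: "0 \<le> P" "0 \<le> Q" using p_bd[of 0] q_bd[of 0] by auto
  show ?thesis
  proof (intro exI[of _ C] conjI allI impI Cpos)
    fix t :: real assume t: "t > 6 * t1"
    then have "0 < t" using t1pos by simp
    note m = main[OF t]
    have w0: "0 \<le> (\<integral>x. w t x \<partial>\<mu>)" by (rule integral_nonneg_AE[OF w_nonneg[OF \<open>0 < t\<close>]])
    show "\<bar>ereal (exp (lam0 * t)) * enn2ereal (heat_content \<mu> u t)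
              - enn2ereal (l1norm \<mu> \<phi>0) * enn2ereal (l1norm \<mu> \<psi>0) / ereal \<Lambda>\<bar>
             \<le> ereal (C * exp (- \<gamma> * t))"
      unfolding heat[OF \<open>0 < t\<close> conjunct1[OF m]] l1
      using conjunct2[OF m] w0 PQ0 Lpos by (simp add: enn2ereal_ennreal)
  qed
qed

end
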